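(* There do not exist integers $X, Y, Z$ with $1 < X \le Y$ and an odd prime $q$ such that $$(X^q-1)(Y^q-1)=Z^q.$$ *)

theory Defs
  imports "HOL-Computational_Algebra.Primes"
begin

end

theory Submission
  imports Defs "HOL-Computational_Algebra.Formal_Power_Series" "HOL-Number_Theory.Cong"
begin

text \<open>
  For \<open>q \<ge> 5\<close> put \<open>N = X ^ q\<close> and \<open>x = (1 - 1 / N) ^ (1 / q)\<close>, so that \<open>Z / (X Y)\<close> is slightly smaller
  than \<open>x\<close>. The diagonal Pade approximants of \<open>(1 - z) ^ (1 / q)\<close> at \<open>z = 1 / N\<close> give integers \<open>P, Q\<close>
  with \<open>P / Q\<close> slightly larger than \<open>x\<close>. Hence the integer \<open>P X Y - Q Z\<close> is positive, and for a suitable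
  degree it is less than 1.

  For \<open>q = 3\<close> these estimates are too weak. Let \<open>\<alpha>, \<beta>\<close> be the real cube roots of \<open>X\<^sup>3 - 1\<close> and
  \<open>Y\<^sup>3 - 1\<close>; as \<open>\<alpha> \<beta> = Z\<close>, both \<open>X - \<alpha>\<close> and \<open>Y - \<beta>\<close> are units of one pure cubic field, whose unit
  rank is 1, so \<open>(X - \<alpha>) ^ n = (Y - \<beta>) ^ m\<close> for some positive \<open>n, m\<close>. Comparing the 3-adic valuations
  of the coordinates of the cubes of both sides, and cubes modulo 9, leaves only the case \<open>{X, Y} \<equiv> {0, 1}\<close> modulo 3, and there
  \<open>n\<close> and \<open>m\<close> must both be divisible by 3, which allows an infinite descent.
\<close>

section \<open>Pade approximation of a binomial power\<close>

text \<open>Pascal's rule turns the sum for \<open>Suc n\<close> at \<open>y\<close> into the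
  difference of the sums for \<open>n\<close> at \<open>y\<close> and \<open>y + 1\<close>. This is
  the partial fraction expansion of the right-hand side; it evaluates the sums that termwise
  integration produces.\<close>

lemma alternating_binomial_sum_inverse:
  fixes y :: real
  assumes "\<And>k. y + of_nat k \<noteq> 0"
  shows "(\<Sum>i\<le>n. (-1) ^ i * of_nat (n choose i) / (y + of_nat i)) = fact n / pochhammer y (Suc n)"
  using assms
proof (induction n arbitrary: y)
  case 0
  then show ?case by simp
next
  case (Suc n)
  let ?f = "\<lambda>n y i. (-1) ^ i * of_nat (n choose i) / (y + of_nat i) :: real"
  have nz: "y + of_nat k \<noteq> 0" for k using Suc.prems .
  have nz': "y + 1 + of_nat k \<noteq> 0" for k using nz[of "Suc k"] by (simp add: add_ac)
  have "(\<Sum>i\<le>Suc n. ?f (Suc n) y i) = ?f (Suc n) y 0 + (\<Sum>i\<le>n. ?f (Suc n) y (Suc i))"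
    by (rule sum.atMost_Suc_shift)
  also have "(\<Sum>i\<le>n. ?f (Suc n) y (Suc i)) = (\<Sum>i\<le>n. ?f n y (Suc i)) - (\<Sum>i\<le>n. ?f n (y + 1) i)"
    unfolding sum_subtractf[symmetric]
    by (intro sum.cong refl) (simp add: add_divide_distrib algebra_simps diff_divide_distrib)
  also have "?f (Suc n) y 0 + \<dots> = (\<Sum>i\<le>Suc n. ?f n y i) - (\<Sum>i\<le>n. ?f n (y + 1) i)"
    by (subst sum.atMost_Suc_shift) simp
  also have "(\<Sum>i\<le>Suc n. ?f n y i) = (\<Sum>i\<le>n. ?f n y i)" by simp
  also have "\<dots> = fact n / pochhammer y (Suc n)" by (rule Suc.IH[OF nz])
  also have "(\<Sum>i\<le>n. ?f n (y + 1) i) = fact n / pochhammer (y + 1) (Suc n)" by (rule Suc.IH[OF nz'])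
  also have "fact n / pochhammer y (Suc n) - fact n / pochhammer (y + 1) (Suc n) =
      fact (Suc n) / pochhammer y (Suc (Suc n))"
  proof -
    have p0: "pochhammer (y+1) n \<noteq> 0" using nz' by (auto simp: pochhammer_eq_0_iff) (metis add.commute add_cancel_left_right nz' diff_add_cancel uminus_add_conv_diff add.right_inverse)
    have y0: "y \<noteq> 0" using nz[of 0] by simp
    have yn: "y + 1 + of_nat n \<noteq> 0" using nz' .
    have e1: "pochhammer y (Suc n) = y * pochhammer (y+1) n" by (rule pochhammer_rec)
    have e2: "pochhammer (y+1) (Suc n) = pochhammer (y+1) n * (y + 1 + of_nat n)" by (simp add: pochhammer_Suc)
    have e3: "pochhammer y (Suc (Suc n)) = y * (pochhammer (y+1) n * (y + 1 + of_nat n))"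
      by (subst pochhammer_rec) (simp only: e2)
    show ?thesis unfolding e1 e2 e3 using p0 y0 yn
      by (simp add: divide_simps) (simp add: algebra_simps)
  qed
  finally show ?case .
qed

text \<open>In the variable \<open>w = 1 - z\<close>, numerator and denominator of the diagonal
  approximant to the \<nu>-th power of \<open>w\<close> have the same coefficients in reverse order,
  so one family serves both.\<close>

definition pade_coeff :: "real \<Rightarrow> nat \<Rightarrow> nat \<Rightarrow> real" where
  "pade_coeff \<nu> n j = (of_nat n - \<nu> gchoose j) * (of_nat n + \<nu> gchoose (n - j))"

lemma pade_coeff_pos:
  assumes "0 < \<nu>" "\<nu> < 1" "j \<le> n"
  shows "pade_coeff \<nu> n j > 0"
  unfolding pade_coeff_def gbinomial_prod_rev using assms
  by (intro mult_pos_pos divide_pos_pos prod_pos) auto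

text \<open>Vandermonde convolution cancels \<nu>. The value bounds the denominator polynomial on
  \<open>0 < w < 1\<close> by \<open>4 ^ n\<close>.\<close>

lemma sum_pade_coeff: "(\<Sum>j\<le>n. pade_coeff \<nu> n j) = of_nat (2 * n choose n)"
proof -
  have "(\<Sum>j\<le>n. pade_coeff \<nu> n j) = ((of_nat n - \<nu>) + (of_nat n + \<nu>)) gchoose n"
    unfolding pade_coeff_def gbinomial_Vandermonde[symmetric] atMost_atLeast0 ..
  also have "(of_nat n - \<nu>) + (of_nat n + \<nu>) = of_nat (2 * n)" by simp
  finally show ?thesis by (simp only: binomial_gbinomial)
qed

text \<open>The constant between the coefficients and the remainder integral. For
  \<open>\<nu> \<noteq> 0\<close> it is the product of \<open>1 - \<nu>^2 / k^2\<close> over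
  \<open>k\<close> from 1 to \<open>n\<close>, which controls its size.\<close>

definition pade_scale :: "real \<Rightarrow> nat \<Rightarrow> real" where
  "pade_scale \<nu> n = (-1) ^ n * pochhammer (\<nu> - of_nat n) (2 * n + 1) / (\<nu> * (fact n)\<^sup>2)"

lemma pade_scale_Suc: 
  "pade_scale \<nu> (Suc n) = pade_scale \<nu> n * (1 - \<nu>\<^sup>2 / (of_nat (Suc n))\<^sup>2)"
proof -
  have "pochhammer (\<nu> - of_nat (Suc n)) (2 * Suc n + 1) = 
    (\<nu> - of_nat (Suc n)) * pochhammer (\<nu> - of_nat n) (2 * n + 1) * (\<nu> + of_nat (Suc n))"
  proof -
    have "2 * Suc n + 1 = Suc (Suc (2 * n + 1))" by simp
    then have "pochhammer (\<nu> - of_nat (Suc n)) (2 * Suc n + 1) = 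
      (\<nu> - of_nat (Suc n)) * pochhammer (\<nu> - of_nat n) (Suc (2 * n + 1))"
      by (simp only: pochhammer_rec) (simp add: algebra_simps)
    also have "pochhammer (\<nu> - of_nat n) (Suc (2 * n + 1)) = 
       pochhammer (\<nu> - of_nat n) (2 * n + 1) * (\<nu> + of_nat (Suc n))"
      by (subst pochhammer_Suc) (simp add: algebra_simps)
    finally show ?thesis by (simp only: mult.assoc)
  qed
  moreover have "(-1) ^ Suc n * ((\<nu> - s) * P * (\<nu> + s)) / (\<nu> * (s * f)\<^sup>2) =
     (-1) ^ n * P / (\<nu> * f\<^sup>2) * (1 - \<nu>\<^sup>2 / s\<^sup>2)" if "s \<noteq> 0" for s P f :: real
    using that by (cases "\<nu> = 0 \<or> f = 0") (auto simp: field_simps power2_eq_square)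
  ultimately show ?thesis
    unfolding pade_scale_def by (simp only: fact_Suc)
qed

lemma pade_scale_bounds:
  assumes "0 < \<nu>" "\<nu> < 1"
  shows "0 < pade_scale \<nu> n \<and> pade_scale \<nu> n \<le> 1"
proof (induction n)
  case 0
  then show ?case using assms by (simp add: pade_scale_def)
next
  case (Suc n)
  have "\<nu>\<^sup>2 / (of_nat (Suc n))\<^sup>2 = (\<nu> / of_nat (Suc n))\<^sup>2" by (simp add: power_divide)
  moreover have "0 \<le> \<nu> / of_nat (Suc n)" "\<nu> / of_nat (Suc n) < 1" using assms by (auto simp: divide_simps)
  then have "0 \<le> (\<nu> / of_nat (Suc n))\<^sup>2 \<and> (\<nu> / of_nat (Suc n))\<^sup>2 < 1"
    using power_strict_mono[of "\<nu> / of_nat (Suc n)" 1 2] by simp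
  ultimately show ?case using Suc unfolding pade_scale_Suc by (auto intro: mult_le_one)
qed

text \<open>The right-hand side is what termwise integration of the remainder integral yields: for
  \<open>\<nu> = 1 / q\<close> the denominators are \<open>q (i + j - n) + 1\<close>. Partial
  fractions at \<open>\<nu> + j - n\<close> collapse the inner sum.\<close>

lemma pade_coeff_eq:
  assumes "0 < \<nu>" "\<nu> < 1" "j \<le> n"
  shows "pade_coeff \<nu> n j = pade_scale \<nu> n * ((-1) ^ (n + j) * of_nat (n choose j) *
    (\<Sum>i\<le>n. (-1) ^ i * of_nat (n choose i) / ((of_nat i + of_nat j - of_nat n) / \<nu> + 1)))"
proof -
  let ?y = "\<nu> + of_nat j - of_nat n"
  have nz: "?y + of_nat k \<noteq> 0" for k
  proof
    assume "?y + of_nat k = 0"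
    then have "\<nu> = of_int (int n - int j - int k)" by simp
    with assms(1,2) have "0 < int n - int j - int k" "int n - int j - int k < 1" by linarith+
    then show False by linarith
  qed
  have "(\<Sum>i\<le>n. (-1) ^ i * of_nat (n choose i) / ((of_nat i + of_nat j - of_nat n) / \<nu> + 1)) = 
    (\<Sum>i\<le>n. \<nu> * ((-1) ^ i * of_nat (n choose i) / (?y + of_nat i)))"
  proof (intro sum.cong refl)
    fix i
    have "(of_nat i + of_nat j - of_nat n) / \<nu> + 1 = (?y + of_nat i) / \<nu>"
      using assms by (simp add: field_simps)
    then show "(-1) ^ i * of_nat (n choose i) / ((of_nat i + of_nat j - of_nat n) / \<nu> + 1) = 
      \<nu> * ((-1) ^ i * of_nat (n choose i) / (?y + of_nat i))" by simp
  qed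
  also have "\<dots> = \<nu> * (fact n / pochhammer ?y (Suc n))"
    by (simp only: sum_distrib_left[symmetric] alternating_binomial_sum_inverse[OF nz])
  finally have S: "(\<Sum>i\<le>n. (-1) ^ i * of_nat (n choose i) / ((of_nat i + of_nat j - of_nat n) / \<nu> + 1))
     = \<nu> * (fact n / pochhammer ?y (Suc n))" .
  have p: "pochhammer ?y (Suc n) \<noteq> 0"
    using nz by (auto simp: pochhammer_eq_0_iff) (metis add.commute add.right_inverse)
  \<comment> \<open>The factors are cut into blocks of length \<open>j\<close>, \<open>n + 1\<close>
    and \<open>n - j\<close>: the outer ones give the two binomials, the middle one cancels against
    the partial fraction sum.\<close>
  have "pochhammer (\<nu> - of_nat n) (2 * n + 1) = 
      pochhammer (\<nu> - of_nat n) j * pochhammer (\<nu> - of_nat n + of_nat j) (2 * n + 1 - j)"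
    using assms(3) by (intro pochhammer_product) auto
  also have "\<nu> - of_nat n + of_nat j = ?y" by simp
  also have "pochhammer ?y (2 * n + 1 - j) = pochhammer ?y (Suc n) * pochhammer (?y + of_nat (Suc n)) (2 * n + 1 - j - Suc n)"
    using assms(3) by (intro pochhammer_product) auto
  also have "2 * n + 1 - j - Suc n = n - j" by simp
  also have "?y + of_nat (Suc n) = \<nu> + of_nat j + 1" by simp
  finally have split: "pochhammer (\<nu> - of_nat n) (2 * n + 1) = 
     pochhammer (\<nu> - of_nat n) j * (pochhammer ?y (Suc n) * pochhammer (\<nu> + of_nat j + 1) (n - j))" .
  have g1: "of_nat n - \<nu> gchoose j = (-1) ^ j * pochhammer (\<nu> - of_nat n) j / fact j"
    by (simp add: gbinomial_pochhammer)
  have "of_nat n + \<nu> - of_nat (n - j) + 1 = \<nu> + of_nat j + 1" using assms(3) by (simp add: of_nat_diff)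
  then have g2: "of_nat n + \<nu> gchoose (n - j) = pochhammer (\<nu> + of_nat j + 1) (n - j) / fact (n - j)"
    by (simp add: gbinomial_pochhammer')
  have ch: "real (n choose j) = fact n / (fact j * fact (n - j))"
    using assms(3) by (rule binomial_fact)
  have sgn: "(-1) ^ n * (-1) ^ (n + j) = ((-1) ^ j :: real)"
    by (simp add: power_add mult.assoc[symmetric] power_mult_distrib[symmetric])
  define s where "s = ((-1)::real) ^ n"
  define s' where "s' = ((-1)::real) ^ (n + j)"
  define s'' where "s'' = ((-1)::real) ^ j"
  have sgn': "s'' = s * s'" using sgn by (simp add: s_def s'_def s''_def)
  show ?thesis
    unfolding S pade_scale_def pade_coeff_def split g1 g2 ch s_def[symmetric] s'_def[symmetric] s''_def[symmetric] sgn'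
    using assms p by (simp add: field_simps power2_eq_square)
qed

section \<open>Integral form of the remainder\<close>

text \<open>The remainder is the integral of \<open>((1 - s ^ q) * (s ^ q - x ^ q) / s ^ q) ^ n\<close> over
  \<open>[x, 1]\<close>; expanding the integrand termwise produces the two polynomials.\<close>

lemma pade_remainder:
  fixes x :: real
  assumes q: "q > 1" and x: "0 < x" "x < 1"
  defines "w \<equiv> x ^ q"
  obtains s where "x < s" "s < 1"
    "(\<Sum>j\<le>n. pade_coeff (1 / of_nat q) n j * w ^ (n - j)) - x * (\<Sum>j\<le>n. pade_coeff (1 / of_nat q) n j * w ^ j)
     = pade_scale (1 / of_nat q) n * ((1 - x) * ((1 - s ^ q) * (s ^ q - w) / s ^ q) ^ n)"
proof -
  define \<nu> where "\<nu> = 1 / real q"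
  have \<nu>: "0 < \<nu>" "\<nu> < 1" using q by (auto simp: \<nu>_def)
  \<comment> \<open>\<open>e i j\<close> is the exponent of \<open>s\<close> in the expanded
    integrand and \<open>d i j\<close> the divisor created by integrating it, nonzero because
    \<open>q > 1\<close> divides \<open>e i j\<close>.\<close>
  define e where "e i j = int q * (int i + int j - int n)" for i j
  define d where "d i j = real_of_int (e i j) + 1" for i j
  define c where "c i j = (-1) ^ i * real (n choose i) * ((-1) ^ (n + j) * real (n choose j) * w ^ (n - j))" for i j
  define \<Phi> where "\<Phi> s = (\<Sum>i\<le>n. \<Sum>j\<le>n. c i j / d i j * s powi (e i j + 1))" for s
  define h where "h s = ((1 - s ^ q) * (s ^ q - w) / s ^ q) ^ n" for s
  have d_nz: "d i j \<noteq> 0" for i j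
  proof
    assume "d i j = 0"
    then have "e i j + 1 = 0" unfolding d_def by (metis of_int_1 of_int_add of_int_eq_0_iff)
    then have "int q dvd 1" unfolding e_def by (metis add.commute dvd_triv_left dvd_add_right_iff dvd_0_right add_eq_0_iff dvd_minus_iff)
    with q show False by simp
  qed
  have d_eq: "d i j = (of_nat i + of_nat j - of_nat n) / \<nu> + 1" for i j
    by (simp add: d_def e_def \<nu>_def mult.commute)
  have d_sym: "d i j = d j i" for i j by (simp add: d_def e_def add.commute)
  have deriv: "(\<Phi> has_real_derivative h s) (at s)" if s: "0 < s" for s
  proof -
    have "(\<Phi> has_real_derivative (\<Sum>i\<le>n. \<Sum>j\<le>n. c i j * s powi (e i j))) (at s)"
      unfolding \<Phi>_def
    proof (intro DERIV_sum)
      fix i j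
      have "((\<lambda>s. c i j / d i j * s powi (e i j + 1)) has_real_derivative 
        c i j / d i j * (of_int (e i j + 1) * s powi (e i j + 1 - 1) * 1)) (at s)"
        using s by (intro DERIV_cmult DERIV_power_int DERIV_ident) auto
      also have "c i j / d i j * (of_int (e i j + 1) * s powi (e i j + 1 - 1) * 1) = c i j * s powi (e i j)"
        using d_nz[of i j] by (simp add: d_def)
      finally show "((\<lambda>s. c i j / d i j * s powi (e i j + 1)) has_real_derivative c i j * s powi (e i j)) (at s)" .
    qed
    also have "(\<Sum>i\<le>n. \<Sum>j\<le>n. c i j * s powi (e i j)) = h s"
    proof -
      have pw: "s powi (e i j) = (s ^ q) ^ i * (s ^ q) ^ j / (s ^ q) ^ n" for i j
        using s by (simp add: e_def power_int_mult power_int_diff power_int_add)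
      have "(1 - s ^ q) ^ n = (\<Sum>i\<le>n. real (n choose i) * (- (s ^ q)) ^ i * 1 ^ (n - i))"
        by (subst binomial_ring[symmetric]) simp
      then have b1: "(1 - s ^ q) ^ n = (\<Sum>i\<le>n. (-1) ^ i * real (n choose i) * (s ^ q) ^ i)"
        by (simp add: power_minus[of "s ^ q"] mult_ac)
      have "(s ^ q - w) ^ n = (\<Sum>j\<le>n. real (n choose j) * (s ^ q) ^ j * (- w) ^ (n - j))"
        by (subst binomial_ring[symmetric]) simp
      also have "\<dots> = (\<Sum>j\<le>n. (-1) ^ (n + j) * real (n choose j) * w ^ (n - j) * (s ^ q) ^ j)"
      proof (intro sum.cong refl)
        fix j assume "j \<in> {..n}"
        then have "n + j = (n - j) + 2 * j" by simp
        then have "(-1::real) ^ (n + j) = (-1) ^ (n - j)" by (simp only: power_add power_mult) simp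
        then show "real (n choose j) * (s ^ q) ^ j * (- w) ^ (n - j) = (-1) ^ (n + j) * real (n choose j) * w ^ (n - j) * (s ^ q) ^ j"
          by (simp add: power_minus[of w])
      qed
      finally have b2: "(s ^ q - w) ^ n = (\<Sum>j\<le>n. (-1) ^ (n + j) * real (n choose j) * w ^ (n - j) * (s ^ q) ^ j)" .
      show ?thesis unfolding h_def power_mult_distrib power_divide b1 b2 sum_product sum_divide_distrib pw c_def
        by (intro sum.cong refl) (simp add: mult_ac)
    qed
    finally show ?thesis .
  qed
  \<comment> \<open>The mean value theorem for the antiderivative \<Phi> replaces the integral of
    \<open>h\<close> over \<open>[x, 1]\<close>.\<close>
  obtain s where s: "x < s" "s < 1" "\<Phi> 1 - \<Phi> x = (1 - x) * h s"
    using MVT2[of x 1 \<Phi> h] x deriv by force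
  have A: "(\<Sum>j\<le>n. pade_coeff \<nu> n j * w ^ (n - j)) = pade_scale \<nu> n * \<Phi> 1"
  proof -
    have "pade_scale \<nu> n * \<Phi> 1 = (\<Sum>j\<le>n. \<Sum>i\<le>n. pade_scale \<nu> n * (c i j / d i j))"
      unfolding \<Phi>_def by (subst sum.swap) (simp add: sum_distrib_left)
    also have "\<dots> = (\<Sum>j\<le>n. pade_coeff \<nu> n j * w ^ (n - j))"
    proof (intro sum.cong refl)
      fix j assume "j \<in> {..n}"
      then have j: "j \<le> n" by simp
      show "(\<Sum>i\<le>n. pade_scale \<nu> n * (c i j / d i j)) = pade_coeff \<nu> n j * w ^ (n - j)"
        unfolding pade_coeff_eq[OF \<nu> j] d_eq[symmetric] sum_distrib_left sum_distrib_right c_def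
        by (intro sum.cong refl) (simp add: mult_ac)
    qed
    finally show ?thesis by simp
  qed
  \<comment> \<open>At the lower end point every power of \<open>x\<close> is \<open>x\<close> times
    a power of \<open>w\<close>. Here the sum over \<open>j\<close> is collapsed, at 1 it was the
    sum over \<open>i\<close>; this reverses the coefficients.\<close>
  have B: "x * (\<Sum>j\<le>n. pade_coeff \<nu> n j * w ^ j) = pade_scale \<nu> n * \<Phi> x"
  proof -
    have "pade_scale \<nu> n * \<Phi> x = (\<Sum>i\<le>n. \<Sum>j\<le>n. pade_scale \<nu> n * (c i j / d i j * x powi (e i j + 1)))"
      unfolding \<Phi>_def by (simp add: sum_distrib_left)
    also have "\<dots> = (\<Sum>i\<le>n. x * (pade_coeff \<nu> n i * w ^ i))"
    proof (intro sum.cong refl)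
      fix i assume "i \<in> {..n}"
      then have i: "i \<le> n" by simp
      show "(\<Sum>j\<le>n. pade_scale \<nu> n * (c i j / d i j * x powi (e i j + 1))) = x * (pade_coeff \<nu> n i * w ^ i)"
        unfolding pade_coeff_eq[OF \<nu> i] d_eq[symmetric] sum_distrib_left sum_distrib_right
      proof (intro sum.cong refl)
        fix j assume "j \<in> {..n}"
        then have j: "j \<le> n" by simp
        have w0: "w \<noteq> 0" using x by (simp add: w_def)
        have "x powi (e i j + 1) = w ^ i * w ^ j / w ^ n * x"
          using x by (simp add: e_def power_int_mult power_int_diff power_int_add w_def)
        moreover have "w ^ n = w ^ (n - j) * w ^ j" using j by (simp flip: power_add)
        ultimately have pw: "w ^ (n - j) * x powi (e i j + 1) = w ^ i * x" using w0 by simp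
        have sg: "(-1::real) ^ i * (-1) ^ (n + j) = (-1) ^ (n + i) * (-1) ^ j" by (simp add: power_add)
        have "pade_scale \<nu> n * (c i j / d i j * x powi (e i j + 1)) = pade_scale \<nu> n * 
          (((-1) ^ i * (-1) ^ (n + j)) * (real (n choose i) * real (n choose j)) / d i j * (w ^ (n - j) * x powi (e i j + 1)))"
          unfolding c_def by (simp add: mult_ac)
        then show "pade_scale \<nu> n * (c i j / d i j * x powi (e i j + 1)) = 
            x * (pade_scale \<nu> n * ((-1) ^ (n + i) * real (n choose i) * ((-1) ^ j * real (n choose j) / d j i)) * w ^ i)"
          unfolding pw sg d_sym[of i j] by (simp add: mult_ac)
      qed
    qed
    finally show ?thesis by (simp add: sum_distrib_left)
  qed
  have "(\<Sum>j\<le>n. pade_coeff \<nu> n j * w ^ (n - j)) - x * (\<Sum>j\<le>n. pade_coeff \<nu> n j * w ^ j)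
     = pade_scale \<nu> n * (\<Phi> 1 - \<Phi> x)" unfolding A B by (simp add: right_diff_distrib)
  then show ?thesis unfolding s(3) h_def \<nu>_def by (rule that[OF s(1,2)])
qed

section \<open>Exponents at least 5\<close>

text \<open>Legendre's recursion: with \<open>m = n div q\<close> the valuation of \<open>n!\<close>
  is \<open>m\<close> plus that of \<open>m!\<close>, so by induction its double is at most
  \<open>3 m \<le> q m \<le> n\<close>.\<close>

lemma multiplicity_fact_le_half:
  assumes "prime q" "q \<ge> 3"
  shows "2 * multiplicity q (fact n :: nat) \<le> n"
proof -
  have pe: "prime_elem q" using assms by auto
  have mult: "multiplicity q (a * b) = multiplicity q a + multiplicity q b" if "a \<noteq> 0" "b \<noteq> 0" for a b :: nat
    using prime_elem_multiplicity_mult_distrib[OF pe that] .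
  have fS: "multiplicity q (fact (Suc k) :: nat) = multiplicity q (Suc k) + multiplicity q (fact k :: nat)" for k
    unfolding fact_Suc using mult[of "Suc k" "fact k"] by simp
  have step: "multiplicity q (fact (q * m + r) :: nat) = multiplicity q (fact (q * m) :: nat)" if "r < q" for m r
    using that
  proof (induction r)
    case (Suc r)
    then have "\<not> q dvd q * m + Suc r"
      by (metis dvd_add_right_iff dvd_triv_left nat_dvd_not_less zero_less_Suc)
    then have "multiplicity q (Suc (q * m + r)) = 0"
      by (intro not_dvd_imp_multiplicity_0) simp
    then show ?case using Suc fS[of "q * m + r"] by simp
  qed simp
  have base: "multiplicity q (fact (q * m) :: nat) = m + multiplicity q (fact m :: nat)" for m
  proof (induction m)
    case (Suc m)
    have "q * Suc m = Suc (q * m + (q - 1))" using assms by simp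
    then have "multiplicity q (fact (q * Suc m) :: nat) =
        multiplicity q (q * Suc m) + multiplicity q (fact (q * m + (q - 1)) :: nat)"
      using fS[of "q * m + (q - 1)"] by metis
    also have "multiplicity q (q * Suc m) = Suc (multiplicity q (Suc m))"
      using assms mult[of q "Suc m"] by simp
    also have "multiplicity q (fact (q * m + (q - 1)) :: nat) = m + multiplicity q (fact m :: nat)"
      using step[of "q - 1" m] Suc.IH assms by simp
    finally show ?case using fS[of m] by simp
  qed simp
  show ?thesis
  proof (induction n rule: less_induct)
    case (less n)
    show ?case
    proof (cases "n = 0")
      case False
      define m where "m = n div q"
      have n: "n = q * m + n mod q" by (simp add: m_def)
      have "m < n" using False assms by (simp add: m_def)
      have "multiplicity q (fact n :: nat) = m + multiplicity q (fact m :: nat)"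
        using step[of "n mod q" m] base[of m] assms n by simp
      moreover have "2 * multiplicity q (fact m :: nat) \<le> m" using less \<open>m < n\<close> by blast
      moreover have "3 * m \<le> q * m" using assms by simp
      ultimately show ?thesis using n by linarith
    qed simp
  qed
qed

text \<open>Away from \<open>q\<close> the progression \<open>c, c - q, c - 2q, \<dots>\<close> is congruent to a multiple of a run of
  consecutive integers, whose product is divisible by \<open>k!\<close>.\<close>

lemma fact_dvd_progression:
  fixes c :: int and q k :: nat
  assumes "prime q"
  shows "(fact k :: int) dvd int q ^ multiplicity q (fact k :: nat) * (\<Prod>i<k. c - int q * int i)"
proof -
  obtain m :: nat where m: "fact k = q ^ multiplicity q (fact k :: nat) * m" "\<not> q dvd m"
    using multiplicity_decompose'[of "fact k :: nat" q] assms
    by (metis fact_nonzero not_prime_unit)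
  have "coprime q m" using assms m(2) by (rule prime_imp_coprime)
  then have co: "coprime (int q) (int m)" by simp
  \<comment> \<open>\<open>t\<close> inverts \<open>q\<close> modulo the part \<open>m\<close> of
    \<open>k!\<close> prime to \<open>q\<close>; multiplying by it turns the step of the progression
    into 1.\<close>
  then obtain t where t: "[int q * t = 1] (mod int m)" using cong_solve_coprime_int by blast
  then have "coprime t (int m)"
    by (metis cong_imp_coprime cong_sym coprime_1_left coprime_mult_left_iff)
  have "[(\<Prod>i<k. t * (c - int q * int i)) = (\<Prod>i<k. t * c - int i)] (mod int m)"
  proof (intro cong_prod)
    fix i
    have "[t * c - (int q * t) * int i = t * c - 1 * int i] (mod int m)"
      by (intro cong_diff cong_mult t cong_refl)
    then show "[t * (c - int q * int i) = t * c - int i] (mod int m)" by (simp add: algebra_simps)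
  qed
  moreover have "(fact k :: int) dvd (\<Prod>i<k. t * c - int i)"
    using gbinomial_int_mult_fact[of k "t * c"] unfolding atLeast0LessThan dvd_def
    by (intro exI) (rule sym)
  then have "int m dvd (\<Prod>i<k. t * c - int i)"
    using m(1) by (metis dvd_mult_right dvd_trans dvd_triv_right of_nat_dvd_iff of_nat_fact)
  ultimately have "int m dvd (\<Prod>i<k. t * (c - int q * int i))" by (simp add: cong_dvd_iff)
  then have "int m dvd t ^ k * (\<Prod>i<k. c - int q * int i)" by (simp add: prod.distrib)
  then have "int m dvd (\<Prod>i<k. c - int q * int i)"
    using \<open>coprime t (int m)\<close> by (simp add: coprime_commute coprime_dvd_mult_right_iff)
  then have "int q ^ multiplicity q (fact k :: nat) * int m dvd int q ^ multiplicity q (fact k :: nat) * (\<Prod>i<k. c - int q * int i)"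
    by (rule mult_dvd_mono[OF dvd_refl])
  then show ?thesis using m(1) by (metis of_nat_fact of_nat_mult of_nat_power)
qed

text \<open>One \<open>q\<close> per factor makes the \<open>k\<close> factors integers in a
  progression of step \<open>q\<close>; the extra power of \<open>q\<close> pays for the division by
  \<open>k!\<close>.\<close>

lemma gbinomial_rational_Ints:
  assumes "prime q"
  shows "real q ^ (k + multiplicity q (fact k :: nat)) * (of_int c / real q gchoose k) \<in> \<int>"
proof -
  have q0: "real q \<noteq> 0" using assms by auto
  have "real q ^ k * (of_int c / real q gchoose k) = (\<Prod>i<k. real q * (of_int c / real q - real i)) / fact k"
    by (simp add: gbinomial_prod_rev prod.distrib lessThan_atLeast0)
  also have "(\<Prod>i<k. real q * (of_int c / real q - real i)) = of_int (\<Prod>i<k. c - int q * int i)"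
    using q0 by (simp add: right_diff_distrib)
  finally have "real q ^ multiplicity q (fact k :: nat) * (real q ^ k * (of_int c / real q gchoose k)) =
     real q ^ multiplicity q (fact k :: nat) * (of_int (\<Prod>i<k. c - int q * int i) / fact k)" by simp
  then have *: "real q ^ (k + multiplicity q (fact k :: nat)) * (of_int c / real q gchoose k) = 
     of_int (int q ^ multiplicity q (fact k :: nat) * (\<Prod>i<k. c - int q * int i)) / of_int (fact k)"
    by (simp add: power_add mult_ac)
  show ?thesis unfolding * using fact_dvd_progression[OF assms, of k c]
    by (metis Ints_of_int of_int_divide_in_Ints)
qed

text \<open>Both binomials are cleared at once because \<open>j! (n - j)!\<close> divides
  \<open>n!\<close>, so their extra powers of \<open>q\<close> fit into that of \<open>n!\<close>;
  \<open>d\<close> is the slack.\<close>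

lemma pade_coeff_Ints:
  assumes "prime q" "j \<le> n"
  shows "real q ^ (n + multiplicity q (fact n :: nat)) * pade_coeff (1 / real q) n j \<in> \<int>"
proof -
  let ?v = "\<lambda>k. multiplicity q (fact k :: nat)"
  have pe: "prime_elem q" using assms by auto
  have q0: "real q \<noteq> 0" using assms by auto
  have "?v j + ?v (n - j) = multiplicity q (fact j * fact (n - j) :: nat)"
    using prime_elem_multiplicity_mult_distrib[OF pe, of "fact j" "fact (n - j)"] by simp
  also have "\<dots> \<le> ?v n"
    by (intro dvd_imp_multiplicity_le) (use assms in \<open>auto simp: binomial_fact_lemma[symmetric]\<close>)
  finally obtain d where d: "?v n = ?v j + ?v (n - j) + d" using le_Suc_ex by blast
  have a1: "of_nat n - 1 / real q = of_int (int q * int n - 1) / real q" 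
    and a2: "of_nat n + 1 / real q = of_int (int q * int n + 1) / real q"
    using q0 by (auto simp: field_simps)
  have "n + ?v n = (j + ?v j) + ((n - j) + ?v (n - j)) + d" using d assms by simp
  then have "real q ^ (n + ?v n) * pade_coeff (1 / real q) n j = 
    real q ^ d * (real q ^ (j + ?v j) * (of_nat n - 1 / real q gchoose j)) * 
     (real q ^ ((n - j) + ?v (n - j)) * (of_nat n + 1 / real q gchoose (n - j)))"
    by (simp only: power_add pade_coeff_def) (simp add: mult_ac)
  also have "\<dots> \<in> \<int>"
    unfolding a1 a2 by (intro Ints_mult gbinomial_rational_Ints assms Ints_power Ints_of_nat)
  finally show ?thesis .
qed

text \<open>Yields \<open>q * sqrt q \<le> 2 * sqrt N\<close> for \<open>N \<ge> 2 ^ q\<close>. The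
  constant 4 is nearly sharp at \<open>q = 5\<close>: 125 against 128.\<close>

lemma cube_le_two_power: "q \<ge> 5 \<Longrightarrow> q ^ 3 \<le> 4 * 2 ^ (q::nat)"
proof (induction q rule: dec_induct)
  case (step q)
  have "Suc q ^ 3 = q ^ 3 + 3 * q ^ 2 + 3 * q + 1" by (simp add: power3_eq_cube power2_eq_square algebra_simps)
  also have "\<dots> \<le> q ^ 3 + q ^ 3"
  proof -
    have "5 * q ^ 2 \<le> q ^ 3" "5 * q \<le> q ^ 2" using step by (auto simp: power3_eq_cube power2_eq_square)
    then show ?thesis using step(1) by linarith
  qed
  finally show ?case using step by simp
qed simp

section \<open>Size and error of the approximants\<close>

text \<open>The upper bound is the inequality of arithmetic and geometric means for
  \<open>1 - u\<close> and \<open>u - w\<close>, whose sum is \<open>1 - w\<close>, followed by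
  \<open>1 / u \<le> 1 / w\<close>.\<close>

lemma pade_integrand_bounds:
  fixes u w :: real
  assumes "0 < w" "w < u" "u < 1"
  shows "0 < (1 - u) * (u - w) / u" "(1 - u) * (u - w) / u \<le> (1 - w)\<^sup>2 / (4 * w)"
proof -
  show "0 < (1 - u) * (u - w) / u" using assms by simp
  have "(1 - u) * (u - w) \<le> (1 - w)\<^sup>2 / 4"
    using zero_le_power2[of "(1 - u) - (u - w)"] by (simp add: power2_eq_square algebra_simps)
  then have "(1 - u) * (u - w) / u \<le> (1 - w)\<^sup>2 / 4 / w"
    using assms by (intro frac_le) auto
  then show "(1 - u) * (u - w) / u \<le> (1 - w)\<^sup>2 / (4 * w)" by simp
qed

text \<open>The scaling factor is \<open>(q N) ^ n\<close> times the \<open>q\<close>-part of \<open>n!\<close>, which is at most \<open>sqrt q ^ n\<close>.\<close>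

lemma pade_approximation:
  fixes N :: int and x :: real
  assumes q: "prime q" "q \<ge> 3" and N: "N > 1" and x: "x > 0" "x ^ q = 1 - 1 / N"
  obtains P Q :: int where "0 < Q" "Q \<le> (4 * real_of_int N * (q * sqrt q)) ^ n"
    "0 < P - x * Q" "P - x * Q \<le> 1 / (q * real_of_int (N - 1)) * (q * sqrt q / (4 * real_of_int (N - 1))) ^ n"
proof -
  define \<nu> where "\<nu> = 1 / real q"
  have \<nu>: "0 < \<nu>" "\<nu> < 1" using q by (auto simp: \<nu>_def)
  define w where "w = x ^ q"
  have w3: "w = (N - 1) / N" using x N by (simp add: w_def divide_simps)
  then have w: "0 < w" "w < 1" "w = (N - 1) / N" using N by auto
  have x1: "x < 1" using x w by (metis linorder_not_less one_le_power w_def)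
  define v where "v = multiplicity q (fact n :: nat)"
  define c where "c = real q ^ (n + v)"
  have c_pos: "c > 0" using q by (simp add: c_def)
  have c_le: "c \<le> (q * sqrt q) ^ n"
  proof -
    have "real q ^ v = sqrt q ^ (2 * v)" by (simp add: power_mult)
    also have "\<dots> \<le> sqrt q ^ n" using multiplicity_fact_le_half[OF q, of n] q
      by (intro power_increasing) (auto simp: v_def)
    finally show ?thesis using q by (simp add: c_def power_add power_mult_distrib)
  qed
  \<comment> \<open>The two polynomials at \<open>w = (N - 1) / N\<close> are multiplied by
    \<open>N ^ n\<close> to clear the powers of \<open>w\<close> and by \<open>c\<close> to clear
    the coefficients.\<close>
  define Qr where "Qr = c * (\<Sum>j\<le>n. pade_coeff \<nu> n j * real_of_int (N ^ (n - j) * (N - 1) ^ j))"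
  define Pr where "Pr = c * (\<Sum>j\<le>n. pade_coeff \<nu> n j * real_of_int (N ^ j * (N - 1) ^ (n - j)))"
  have "Qr = (\<Sum>j\<le>n. (c * pade_coeff \<nu> n j) * of_int (N ^ (n - j) * (N - 1) ^ j))"
    "Pr = (\<Sum>j\<le>n. (c * pade_coeff \<nu> n j) * of_int (N ^ j * (N - 1) ^ (n - j)))"
    by (simp_all only: Qr_def Pr_def sum_distrib_left mult.assoc)
  then have "Qr \<in> \<int>" "Pr \<in> \<int>"
    unfolding c_def v_def \<nu>_def
    by (auto simp only: atMost_iff intro!: Ints_sum Ints_mult[OF _ Ints_of_int] pade_coeff_Ints q)
  then obtain P Q :: int where PQ: "Pr = P" "Qr = Q" by (auto elim!: Ints_cases)
  have Nw: "N ^ n * w ^ j = N ^ (n - j) * (N - 1) ^ j" if "j \<le> n" for j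
  proof -
    have "N ^ n * w ^ j = N ^ (n - j) * (N * w) ^ j"
      using that by (simp add: power_mult_distrib mult.assoc[symmetric] flip: power_add)
    moreover have "N * w = N - 1" using w N by simp
    ultimately show ?thesis by simp
  qed
  have Q_eq: "Qr = c * N ^ n * (\<Sum>j\<le>n. pade_coeff \<nu> n j * w ^ j)"
    unfolding Qr_def mult.assoc sum_distrib_left using Nw
    by (intro sum.cong refl) (simp add: mult_ac)
  have P_eq: "Pr = c * N ^ n * (\<Sum>j\<le>n. pade_coeff \<nu> n j * w ^ (n - j))"
    unfolding Pr_def mult.assoc sum_distrib_left using Nw[of "n - _"]
    by (intro sum.cong refl) (simp add: mult_ac)
  have Npos: "real_of_int N ^ n > 0" using N by simp
  have "Qr > 0" unfolding Q_eq using c_pos N w pade_coeff_pos[OF \<nu>]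
    by (intro mult_pos_pos sum_pos) auto
  moreover have "Qr \<le> (4 * real_of_int N * (q * sqrt q)) ^ n"
  proof -
    have "(\<Sum>j\<le>n. pade_coeff \<nu> n j * w ^ j) \<le> (\<Sum>j\<le>n. pade_coeff \<nu> n j)"
      using w pade_coeff_pos[OF \<nu>] by (intro sum_mono mult_left_le power_le_one) (auto intro: less_imp_le)
    also have "\<dots> = real (2 * n choose n)" by (rule sum_pade_coeff)
    also have "\<dots> \<le> real (2 ^ (2 * n))" using binomial_le_pow2 of_nat_le_iff by blast
    also have "\<dots> = 4 ^ n" by (simp add: power_mult)
    finally have "Qr \<le> (q * sqrt q) ^ n * N ^ n * 4 ^ n"
      unfolding Q_eq using c_le c_pos N w pade_coeff_pos[OF \<nu>]
      by (intro mult_mono) (auto intro!: sum_nonneg mult_nonneg_nonneg intro: less_imp_le)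
    then show ?thesis by (simp add: power_mult_distrib mult_ac)
  qed
  moreover obtain s where s: "x < s" "s < 1" and 
    rem: "(\<Sum>j\<le>n. pade_coeff \<nu> n j * w ^ (n - j)) - x * (\<Sum>j\<le>n. pade_coeff \<nu> n j * w ^ j)
     = pade_scale \<nu> n * ((1 - x) * ((1 - s ^ q) * (s ^ q - w) / s ^ q) ^ n)"
    using pade_remainder[of q x n] q x x1 unfolding \<nu>_def w_def by auto
  have rem': "Pr - x * Qr = c * N ^ n * (pade_scale \<nu> n * ((1 - x) * ((1 - s ^ q) * (s ^ q - w) / s ^ q) ^ n))"
    unfolding rem[symmetric] P_eq Q_eq by (simp add: algebra_simps)
  have sq: "w < s ^ q" "s ^ q < 1" using s x(1) q
    power_strict_mono[of x s q] power_strict_mono[of s 1 q] by (auto simp: w_def)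
  note h = pade_integrand_bounds[OF w(1) sq]
  note K = pade_scale_bounds[OF \<nu>, of n]
  have "Pr - x * Qr > 0" unfolding rem' using c_pos N x1 h(1) K by (intro mult_pos_pos zero_less_power) auto
  moreover have "Pr - x * Qr \<le> 1 / (q * real_of_int (N - 1)) * (q * sqrt q / (4 * real_of_int (N - 1))) ^ n"
  proof -
    have "1 - x \<le> 1 / (q * real_of_int (N - 1))"
    proof -
      \<comment> \<open>Bernoulli is applied to \<open>1 / x\<close>, whose \<open>q\<close>-th
        power is \<open>N / (N - 1)\<close>; then \<open>1 - x \<le> 1 / x - 1\<close>.\<close>
      have "1 + real q * (1 / x - 1) \<le> (1 + (1 / x - 1)) ^ q"
        using x x1 by (intro Bernoulli_inequality) (simp add: divide_simps)
      also have "\<dots> = 1 / w" by (simp add: w_def power_divide)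
      also have "\<dots> = 1 + 1 / (N - 1)" using N by (simp add: w(3) divide_simps)
      finally have "real q * (1 / x - 1) \<le> 1 / (N - 1)" by simp
      moreover have "1 - x \<le> 1 / x - 1"
        using x(1) zero_le_power2[of "1 - x"] by (simp add: divide_simps power2_eq_square algebra_simps)
      then have "real q * (1 - x) \<le> real q * (1 / x - 1)" by (intro mult_left_mono) auto
      ultimately have "real q * (1 - x) \<le> 1 / (N - 1)" by linarith
      then show ?thesis using q N by (simp add: field_simps)
    qed
    then have "Pr - x * Qr \<le> (q * sqrt q) ^ n * N ^ n * (1 * (1 / (q * real_of_int (N - 1)) * ((1 - w)\<^sup>2 / (4 * w)) ^ n))"
      unfolding rem' using c_le c_pos N K h x1 w
      by (intro mult_mono power_mono mult_nonneg_nonneg zero_le_power less_imp_le[OF h(1)]) auto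
    also have "\<dots> = 1 / (q * real_of_int (N - 1)) * ((q * sqrt q) * real_of_int N * ((1 - w)\<^sup>2 / (4 * w))) ^ n"
      by (simp only: power_mult_distrib mult_1 mult_ac of_int_power)
    also have "real_of_int N * ((1 - w)\<^sup>2 / (4 * w)) = 1 / (4 * real_of_int (N - 1))"
      using N by (simp add: w(3) divide_simps power2_eq_square) 
    then have "(q * sqrt q) * real_of_int N * ((1 - w)\<^sup>2 / (4 * w)) = q * sqrt q / (4 * real_of_int (N - 1))"
      by (metis mult.assoc mult.right_neutral times_divide_eq_right)
    finally show ?thesis .
  qed
  ultimately show ?thesis using that[of Q P] unfolding PQ by simp
qed

section \<open>The contradiction for exponents at least 5\<close>

text \<open>With \<open>T = X Y\<close> and \<open>Z = T x r\<close>, the integer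
  \<open>P X Y - Q Z\<close> splits into the positive terms \<open>T (P - x Q)\<close> and
  \<open>T Q x (1 - r)\<close>. The degree \<open>n\<close> is the least for which the error bound
  puts the first below \<open>1/2\<close>; minimality keeps \<open>Q\<close> small enough for the
  second to be at most \<open>1/2\<close>.\<close>

lemma no_solution_exponent_ge_5:
  fixes X Y Z :: int
  assumes q: "prime q" "q \<ge> 5" and XY: "1 < X" "X \<le> Y" and Z: "Z > 0"
    and eq: "(X ^ q - 1) * (Y ^ q - 1) = Z ^ q"
  shows False
proof -
  define N where "N = X ^ q"
  define R where "R = sqrt N"
  define T where "T = real_of_int X * real_of_int Y"
  have "(2::int) ^ 5 \<le> 2 ^ q" using q by (intro power_increasing) auto
  also have "2 ^ q \<le> N" unfolding N_def using XY by (intro power_mono) auto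
  finally have N: "N \<ge> 32" by simp
  have R2: "R ^ 2 = N" using N by (simp add: R_def)
  have R1: "R \<ge> 1" using N by (simp add: R_def)
  have X5: "real_of_int X ^ 5 \<le> R ^ 2"
    unfolding R2 N_def of_int_power using XY q by (intro power_increasing) auto
  have T_pos: "T > 0" using XY by (simp add: T_def)

  define x where "x = root q (1 - 1 / N)"
  have x: "x > 0" "x ^ q = 1 - 1 / N" using N q by (auto simp: x_def)
  have x1: "x \<le> 1" unfolding x_def using N q by (simp add: real_root_le_1_iff)
  \<comment> \<open>\<open>x\<close> accounts for the defect of \<open>X ^ q - 1\<close> against
    \<open>X ^ q\<close>; \<open>r\<close> is the corresponding factor for \<open>Y\<close>.\<close>
  define r where "r = Z / (T * x)"
  have r_pos: "r > 0" using Z T_pos x by (simp add: r_def)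
  have Z_eq: "real_of_int Z = T * x * r" using T_pos x by (simp add: r_def)
  have Yq: "real_of_int Y ^ q > 1" using XY q by (intro one_less_power) auto
  have r_q: "r ^ q = 1 - 1 / real_of_int Y ^ q"
  proof -
    have "real_of_int ((X ^ q - 1) * (Y ^ q - 1)) = real_of_int (Z ^ q)" using eq by simp
    then have "(real_of_int X ^ q - 1) * (real_of_int Y ^ q - 1) = T ^ q * x ^ q * r ^ q"
      by (simp add: Z_eq power_mult_distrib)
    also have "T ^ q * x ^ q = real_of_int Y ^ q * (real_of_int X ^ q - 1)"
      unfolding x(2) N_def T_def using XY by (simp add: power_mult_distrib divide_simps algebra_simps)
    finally have "(real_of_int X ^ q - 1) * (real_of_int Y ^ q - 1) = (real_of_int X ^ q - 1) * (real_of_int Y ^ q * r ^ q)"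
      by (simp only: mult_ac)
    moreover have "real_of_int N > 1" using N by simp
    then have "real_of_int X ^ q - 1 \<noteq> 0" by (simp add: N_def)
    ultimately have "real_of_int Y ^ q - 1 = real_of_int Y ^ q * r ^ q" by simp
    moreover have "real_of_int Y ^ q \<noteq> 0" using Yq by linarith
    ultimately have "r ^ q = (real_of_int Y ^ q - 1) / real_of_int Y ^ q" by (simp add: nonzero_eq_divide_eq mult.commute)
    then show ?thesis using XY by (simp add: diff_divide_distrib)
  qed
  have "r < 1"
  proof (rule ccontr)
    assume "\<not> r < 1"
    then have "1 \<le> r ^ q" by (intro one_le_power) simp
    then show False using r_q Yq by simp
  qed
  have "r ^ q \<le> r" using r_pos \<open>r < 1\<close> q power_decreasing[of 1 q r] by simp
  then have r_close: "1 - r \<le> 1 / real_of_int Y ^ q" using r_q by simp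

  have s3: "real q * sqrt q \<le> 2 * R"
  proof -
    have "real q * sqrt q = sqrt (real q ^ 3)"
      by (simp add: power3_eq_cube real_sqrt_mult)
    also have "real q ^ 3 \<le> real (4 * 2 ^ q)" using cube_le_two_power[OF q(2)]
      by (simp only: of_nat_power[symmetric] of_nat_le_iff)
    also have "real (4 * 2 ^ q) = 4 * real_of_int (2 ^ q)" by simp
    also have "\<dots> \<le> 4 * real_of_int N" using \<open>2 ^ q \<le> N\<close> by (simp only: of_int_le_iff mult_le_cancel_left_pos zero_less_numeral)
    also have "sqrt (4 * real_of_int N) = 2 * R" by (simp add: R_def real_sqrt_mult)
    finally show ?thesis by simp
  qed
  have a: "real_of_int (N - 1) \<ge> 31 / 32 * R ^ 2" unfolding R2 using N by simp

  \<comment> \<open>The constants come from \<open>q \<ge> 5\<close>,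
    \<open>N - 1 \<ge> 31/32 R^2\<close> and \<open>q * sqrt q \<le> 2 R\<close>: the prefactor is
    \<open>1 / (5 * 31/32)\<close> and the ratio is \<open>2 / (4 * 31/32)\<close>.\<close>
  define \<epsilon> where "\<epsilon> n = 32 / (155 * R ^ 2) * (16 / (31 * R)) ^ n" for n
  have approx: "\<exists>(P::int) (Q::int). (0::int) < Q \<and> Q \<le> (8 * R ^ 3) ^ n \<and> 0 < P - x * Q \<and> P - x * Q \<le> \<epsilon> n" for n
  proof -
    obtain P Q :: int where PQ: "0 < Q" "Q \<le> (4 * real_of_int N * (q * sqrt q)) ^ n" "0 < P - x * Q"
      "P - x * Q \<le> 1 / (q * real_of_int (N - 1)) * (q * sqrt q / (4 * real_of_int (N - 1))) ^ n"
      by (rule pade_approximation[OF q(1) _ _ x, of n]) (use q N in auto)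
    note PQ(2)
    also have "(4 * real_of_int N * (q * sqrt q)) ^ n \<le> (4 * R ^ 2 * (2 * R)) ^ n"
      unfolding R2 using s3 N by (intro power_mono mult_left_mono) auto
    also have "4 * R ^ 2 * (2 * R) = 8 * R ^ 3" by (simp add: power2_eq_square power3_eq_cube)
    finally have 1: "Q \<le> (8 * R ^ 3) ^ n" .
    note PQ(4)
    also have "1 / (q * real_of_int (N - 1)) * (q * sqrt q / (4 * real_of_int (N - 1))) ^ n \<le> 
       1 / (5 * (31 / 32 * R ^ 2)) * (2 * R / (4 * (31 / 32 * R ^ 2))) ^ n"
    proof (rule mult_mono)
      have "5 * (31 / 32 * R ^ 2) \<le> q * real_of_int (N - 1)"
        using q a R1 by (intro mult_mono) auto
      then show "1 / (q * real_of_int (N - 1)) \<le> 1 / (5 * (31 / 32 * R ^ 2))"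
        using R1 by (intro frac_le) auto
      have "q * sqrt q / (4 * real_of_int (N - 1)) \<le> 2 * R / (4 * (31 / 32 * R ^ 2))"
        by (rule frac_le) (use s3 a R1 in auto)
      then show "(q * sqrt q / (4 * real_of_int (N - 1))) ^ n \<le> (2 * R / (4 * (31 / 32 * R ^ 2))) ^ n"
        using N by (intro power_mono) auto
    qed (use R1 N in auto)
    also have "\<dots> = \<epsilon> n" using R1 by (simp add: \<epsilon>_def power2_eq_square field_simps)
    finally show ?thesis using PQ 1 by (intro exI[of _ P] exI[of _ Q]) simp
  qed

  have "(\<lambda>n. (16 / (31 * R)) ^ n) \<longlonglongrightarrow> 0" using R1 by (intro LIMSEQ_realpow_zero) (auto simp: divide_simps)
  then have "(\<lambda>n. 2 * T * (32 / (155 * R ^ 2) * (16 / (31 * R)) ^ n)) \<longlonglongrightarrow> 2 * T * (32 / (155 * R ^ 2) * 0)"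
    by (intro tendsto_mult tendsto_const)
  then have "\<forall>\<^sub>F n in sequentially. 2 * T * \<epsilon> n < 1"
    unfolding \<epsilon>_def by (intro order_tendstoD(2)[of _ 0]) auto
  then have ex: "\<exists>n. 2 * T * \<epsilon> n < 1" by (auto simp: eventually_sequentially)
  define n where "n = (LEAST n. 2 * T * \<epsilon> n < 1)"
  have n: "2 * T * \<epsilon> n < 1" unfolding n_def using ex by (rule LeastI_ex)
  have n_least: "2 * T * \<epsilon> m \<ge> 1" if "m < n" for m
    using not_less_Least[of m "\<lambda>n. 2 * T * \<epsilon> n < 1"] that unfolding n_def by simp

  obtain P Q :: int where PQ: "0 < Q" "Q \<le> (8 * R ^ 3) ^ n" "0 < P - x * Q" "P - x * Q \<le> \<epsilon> n"
    using approx by blast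
  have small: "2 * T * Q \<le> real_of_int Y ^ q"
  proof (cases n)
    case 0
    then have "real_of_int Q \<le> 1" using PQ(2) by simp
    then have "2 * T * Q \<le> 2 * T" using T_pos by simp
    also have "2 * T \<le> real_of_int Y * real_of_int Y * real_of_int Y" unfolding T_def mult.assoc[symmetric] using XY
      by (intro mult_mono) auto
    also have "\<dots> = real_of_int Y ^ 3" by (simp add: power3_eq_cube)
    also have "\<dots> \<le> real_of_int Y ^ q" using XY q by (intro power_increasing) auto
    finally show ?thesis .
  next
    case (Suc m)
    \<comment> \<open>Degree \<open>m\<close> still fails, which bounds \<open>T\<close> from below.
      In the fourth power, \<open>(31/16)^4 R^4\<close> per degree dominates the growth
      \<open>8 R^3\<close> of \<open>Q\<close> and leaves room for \<open>X^5 \<le> R^2\<close>;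
      cancelling \<open>X^4\<close> gives \<open>2 X Q \<le> Y^4\<close>.\<close>
    have "1 \<le> 2 * T * \<epsilon> m" using n_least[of m] Suc by simp
    then have "155 / 64 * R ^ 2 * (31 * R / 16) ^ m \<le> T"
      using R1 by (simp add: \<epsilon>_def power_divide divide_simps mult_ac)
    then have "(155 / 64 * R ^ 2 * (31 * R / 16) ^ m) ^ 4 \<le> T ^ 4"
      using R1 by (intro power_mono) auto
    also have "(155 / 64 * R ^ 2 * (31 * R / 16) ^ m) ^ 4 = (155 / 64) ^ 4 * R ^ 8 * ((31 / 16) ^ 4 * R ^ 4) ^ m"
      by (simp only: power_mult_distrib power_mult[symmetric] power_divide mult.commute[of m 4]) simp
    finally have T4: "(155 / 64) ^ 4 * R ^ 8 * ((31 / 16) ^ 4 * R ^ 4) ^ m \<le> T ^ 4" .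
    have "2 * real_of_int X ^ 5 * Q \<le> 2 * R ^ 2 * (8 * R ^ 3) ^ n"
      using X5 PQ(1,2) R1 XY by (intro mult_mono) auto
    also have "\<dots> = 16 * R ^ 5 * (8 * R ^ 3) ^ m" unfolding Suc
      by (simp add: eval_nat_numeral)
    also have "\<dots> \<le> (155 / 64) ^ 4 * R ^ 8 * ((31 / 16) ^ 4 * R ^ 4) ^ m"
      using R1 by (intro mult_mono power_mono power_increasing) (auto simp: power_divide)
    also note T4
    also have "T ^ 4 = real_of_int X ^ 4 * real_of_int Y ^ 4" by (simp add: T_def power_mult_distrib)
    finally have "real_of_int X ^ 4 * (2 * X * Q) \<le> real_of_int X ^ 4 * real_of_int Y ^ 4"
      by (simp add: eval_nat_numeral mult_ac)
    then have "2 * real_of_int X * Q \<le> real_of_int Y ^ 4" using XY by simp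
    then have "2 * real_of_int X * Q * Y \<le> real_of_int Y ^ 4 * Y" using XY by (intro mult_right_mono) auto
    also have "\<dots> = real_of_int Y ^ 5" by (simp add: eval_nat_numeral)
    also have "\<dots> \<le> real_of_int Y ^ q" using XY q by (intro power_increasing) auto
    finally show ?thesis by (simp add: T_def mult_ac)
  qed
  have \<Delta>: "real_of_int (P * X * Y - Q * Z) = T * (P - x * Q) + T * Q * (x * (1 - r))"
    by (simp add: Z_eq T_def algebra_simps)
  have "T * Q * (x * (1 - r)) > 0" using T_pos PQ(1) x(1) \<open>r < 1\<close> by simp
  moreover have "T * (P - x * Q) > 0" using T_pos PQ(3) by simp
  ultimately have "real_of_int (P * X * Y - Q * Z) > 0" unfolding \<Delta> by linarith
  then have "P * X * Y - Q * Z \<ge> 1" by linarith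
  then have "real_of_int (P * X * Y - Q * Z) \<ge> 1" by linarith
  moreover have "T * (P - x * Q) \<le> T * \<epsilon> n" using T_pos PQ(4) by simp
  moreover have "T * Q * (x * (1 - r)) \<le> 1 / 2"
  proof -
    have "x * (1 - r) \<le> 1 * (1 / real_of_int Y ^ q)"
      using x1 x r_close \<open>r < 1\<close> by (intro mult_mono) auto
    then have "T * Q * (x * (1 - r)) \<le> T * Q * (1 / real_of_int Y ^ q)"
      using T_pos PQ(1) by (intro mult_left_mono) auto
    also have "\<dots> \<le> 1 / 2" using small Yq by (simp add: divide_simps)
    finally show ?thesis .
  qed
  ultimately show False using n unfolding \<Delta> by linarith
qed

section \<open>Units of pure cubic fields\<close>

text \<open>The order \<open>\<int>[\<theta>]\<close> when \<open>\<theta> ^ 3\<close> is an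
  integer. Its elements are real numbers rather than coordinate triples, so units of two different
  orders can be compared by equality.\<close>

definition cubic_ring :: "real \<Rightarrow> real set" where
  "cubic_ring \<theta> = {of_int u + of_int v * \<theta> + of_int w * \<theta>\<^sup>2 | u v w. True}"

lemma cubic_ringI: "of_int u + of_int v * \<theta> + of_int w * \<theta>\<^sup>2 \<in> cubic_ring \<theta>"
  unfolding cubic_ring_def by blast

lemma cubic_ringE:
  assumes "x \<in> cubic_ring \<theta>"
  obtains u v w :: int where "x = of_int u + of_int v * \<theta> + of_int w * \<theta>\<^sup>2"
  using assms unfolding cubic_ring_def by blast

lemma cubic_ring_of_int [simp]: "of_int u \<in> cubic_ring \<theta>"
  using cubic_ringI[of u 0 \<theta> 0] by simp

lemma cubic_ring_generator [simp]: "\<theta> \<in> cubic_ring \<theta>"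
  using cubic_ringI[of 0 1 \<theta> 0] by simp

lemma cubic_ring_add:
  assumes "x \<in> cubic_ring \<theta>" "y \<in> cubic_ring \<theta>"
  shows "x + y \<in> cubic_ring \<theta>"
proof -
  obtain u v w where "x = of_int u + of_int v * \<theta> + of_int w * \<theta>\<^sup>2" using assms(1) by (rule cubic_ringE)
  moreover obtain u' v' w' where "y = of_int u' + of_int v' * \<theta> + of_int w' * \<theta>\<^sup>2" using assms(2) by (rule cubic_ringE)
  ultimately have "x + y = of_int (u + u') + of_int (v + v') * \<theta> + of_int (w + w') * \<theta>\<^sup>2"
    by (simp add: algebra_simps)
  then show ?thesis by (metis cubic_ringI)
qed

lemma cubic_ring_mult:
  assumes "\<theta> ^ 3 = of_int d" "x \<in> cubic_ring \<theta>" "y \<in> cubic_ring \<theta>"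
  shows "x * y \<in> cubic_ring \<theta>"
proof -
  obtain u v w where x: "x = of_int u + of_int v * \<theta> + of_int w * \<theta>\<^sup>2" using assms(2) by (rule cubic_ringE)
  obtain u' v' w' where y: "y = of_int u' + of_int v' * \<theta> + of_int w' * \<theta>\<^sup>2" using assms(3) by (rule cubic_ringE)
  have "x * y = of_int (u * u' + d * (v * w' + w * v')) + of_int (u * v' + v * u' + d * w * w') * \<theta>
     + of_int (u * w' + v * v' + w * u') * \<theta>\<^sup>2"
    unfolding x y of_int_add of_int_mult assms(1)[symmetric]
    by (simp add: algebra_simps power2_eq_square power3_eq_cube)
  then show ?thesis by (metis cubic_ringI)
qed

lemma cubic_ring_power:
  assumes "\<theta> ^ 3 = of_int d" "x \<in> cubic_ring \<theta>"
  shows "x ^ n \<in> cubic_ring \<theta>"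
  using cubic_ring_of_int[of 1] cubic_ring_mult[OF assms(1) assms(2)] by (induction n) auto

lemma cubic_ring_diff:
  assumes "\<theta> ^ 3 = of_int d" "x \<in> cubic_ring \<theta>" "y \<in> cubic_ring \<theta>"
  shows "x - y \<in> cubic_ring \<theta>"
  using cubic_ring_add[OF assms(2) cubic_ring_mult[OF assms(1) cubic_ring_of_int[of "-1"] assms(3)]] by simp

lemma cubic_ring_sum:
  assumes "\<And>i. i \<in> I \<Longrightarrow> f i \<in> cubic_ring \<theta>"
  shows "sum f I \<in> cubic_ring \<theta>"
  using assms cubic_ring_of_int[of 0] by (induction I rule: infinite_finite_induct) (auto intro: cubic_ring_add)

text \<open>Multiplying by \<open>w \<alpha>\<close> and eliminating \<open>\<alpha>^2\<close>
  leaves a linear relation for \<alpha>. Irrationality forces \<open>v^2 = u w\<close> and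
  \<open>w^2 a = u v\<close>, so \<open>v^3 = w^3 a\<close>, and \<open>w \<noteq> 0\<close> would
  make \<alpha> equal to \<open>v / w\<close>.\<close>

lemma cubic_independent:
  fixes \<alpha> :: real and a u v w :: int
  assumes "\<alpha> ^ 3 = of_int a" "\<alpha> \<notin> \<rat>" "of_int u + of_int v * \<alpha> + of_int w * \<alpha>\<^sup>2 = 0"
  shows "u = 0 \<and> v = 0 \<and> w = 0"
proof -
  have rat: "p = 0 \<and> r = 0" if "of_int p * \<alpha> = of_int r" for p r :: int
  proof -
    have "p = 0"
    proof (rule ccontr)
      assume "p \<noteq> 0"
      with that have "\<alpha> = of_int r / of_int p" by (simp add: field_simps)
      then show False using assms(2) by (metis Rats_divide Rats_of_int)
    qed
    then show ?thesis using that by simp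
  qed
  have w2: "of_int w * \<alpha>\<^sup>2 = - of_int u - of_int v * \<alpha>" using assms(3) by linarith
  have "of_int w * (of_int w * of_int a) = of_int w * (of_int w * \<alpha>\<^sup>2) * \<alpha>"
    unfolding assms(1)[symmetric] by (simp add: power2_eq_square power3_eq_cube)
  also have "\<dots> = of_int w * (- of_int u - of_int v * \<alpha>) * \<alpha>" unfolding w2 ..
  also have "\<dots> = - of_int u * of_int w * \<alpha> - of_int v * (of_int w * \<alpha>\<^sup>2)"
    by (simp add: algebra_simps power2_eq_square)
  also have "\<dots> = of_int (v * v - u * w) * \<alpha> + of_int (u * v)"
    unfolding w2 by (simp add: algebra_simps)
  finally have "of_int (v * v - u * w) * \<alpha> = of_int (w * w * a - u * v)" by simp
  from rat[OF this] have e: "v * v = u * w" "w * w * a = u * v" by auto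
  have "w = 0"
  proof (rule ccontr)
    assume w: "w \<noteq> 0"
    have "v ^ 3 = w ^ 3 * a" using e by (simp add: power3_eq_cube)
    then have "of_int v ^ 3 = (of_int w * \<alpha>) ^ 3" 
      by (metis assms(1) of_int_mult of_int_power power_mult_distrib)
    then have "root 3 (of_int v ^ 3) = root 3 ((of_int w * \<alpha>) ^ 3)" by simp
    then have "of_int v = of_int w * \<alpha>" using odd_real_root_power_cancel[of 3] by simp
    then show False using rat[of w v] w by simp
  qed
  then show ?thesis using rat[of v "- u"] assms(3) by simp
qed

text \<open>A rational \<alpha> would be an integer, but \<open>X^3 - 1\<close> lies strictly
  between the consecutive cubes \<open>(X - 1)^3\<close> and \<open>X^3\<close>.\<close>

lemma unit_cube_root_irrational:
  fixes X :: int and \<alpha> :: real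
  assumes "X > 1" "\<alpha> ^ 3 = of_int (X ^ 3 - 1)" "\<alpha> > 0"
  shows "\<alpha> \<notin> \<rat>"
proof
  assume "\<alpha> \<in> \<rat>"
  then obtain p q :: int where pq: "q > 0" "coprime p q" "\<alpha> = of_int p / of_int q"
    by (metis Rats_cases' )
  have "of_int (p ^ 3) = (of_int (q ^ 3 * (X ^ 3 - 1)) :: real)"
    using assms(2) pq by (simp add: power_divide field_simps)
  then have "p ^ 3 = q ^ 3 * (X ^ 3 - 1)" by (simp only: of_int_eq_iff)
  then have "q ^ 3 dvd p ^ 3" by simp
  moreover have "coprime (q ^ 3) (p ^ 3)" using pq by (simp add: coprime_commute)
  ultimately have "is_unit (q ^ 3)" by (metis coprime_absorb_left)
  then have "is_unit q" using is_unit_power_iff[of q 3] by simp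
  then have "q = 1" using pq by simp
  then have p: "p ^ 3 = X ^ 3 - 1" using \<open>p ^ 3 = q ^ 3 * (X ^ 3 - 1)\<close> by simp
  have "p < X" using p power_mono[of X p 3] assms(1) by (intro linorder_not_le[THEN iffD1]) auto
  then have "p \<le> X - 1" by simp
  then have "p ^ 3 \<le> (X - 1) ^ 3" by (intro power_mono_odd) auto
  also have "(X - 1) ^ 3 < X ^ 3 - 1"
  proof -
    have "X ^ 3 - 1 - (X - 1) ^ 3 = 3 * X * (X - 1)" by (simp add: power3_eq_cube algebra_simps)
    moreover have "3 * X * (X - 1) > 0" using assms(1) by simp
    ultimately show ?thesis by linarith
  qed
  finally show False using p by simp
qed

section \<open>Three-adic expansion of unit powers\<close>

text \<open>From \<open>(x - \<theta>)\<^sup>3 = 1 + 3x(\<theta>\<^sup>2 - x\<theta>)\<close>; the binomial expansion of the \<open>n\<close>-th power is dominated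
  3-adically by its linear term.\<close>

lemma unit_power_cubed:
  fixes x :: int and \<theta> :: real
  assumes \<theta>: "\<theta> ^ 3 = of_int (x ^ 3 - 1)" and n: "n > 0"
  defines "v \<equiv> multiplicity 3 (int n)"
  obtains W0 W1 W2 :: int where
    "(of_int x - \<theta>) ^ (3 * n) = of_int W0 + of_int (3 * x\<^sup>2 * (3 ^ (v + 1) * W1 - int n)) * \<theta>
       + of_int (3 * x * (int n + 3 ^ (v + 1) * W2)) * \<theta>\<^sup>2"
proof -
  define U where "U = \<theta>\<^sup>2 - of_int x * \<theta>"
  have U: "U \<in> cubic_ring \<theta>" using cubic_ringI[of 0 "-x" \<theta> 1] by (simp add: U_def)
  have "(of_int x - \<theta>) ^ 3 = of_int x ^ 3 - \<theta> ^ 3 + 3 * of_int x * U"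
    by (simp add: U_def algebra_simps power2_eq_square power3_eq_cube)
  then have cube: "(of_int x - \<theta>) ^ 3 = of_int (3 * x) * U + 1" by (simp add: \<theta>)
  \<comment> \<open>From \<open>k * (n choose k) = n * ((n - 1) choose (k - 1))\<close> the binomial
    loses at most \<open>t\<close>, the 3-adic valuation of \<open>k\<close>, against
    \<open>v\<close>. Since \<open>3^t \<le> k < 3^(k - 1)\<close> gives
    \<open>t + 2 \<le> k\<close>, the factor \<open>3^k\<close> makes up for this with two powers to
    spare.\<close>
  have c: "\<exists>c. int (n choose k) * (3 * x) ^ k = 3 ^ (v + 2) * x\<^sup>2 * c" if k: "k \<ge> 2" for k
  proof -
    have "k < 3 ^ (k - 1)" using k
    proof (induction k rule: dec_induct)
      case (step k)
      have "(3::nat) ^ (Suc k - 1) = 3 * 3 ^ (k - 1)" using step(1) by (simp flip: power_Suc)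
      then show ?case using step by linarith
    qed simp
    define t where "t = multiplicity 3 (int k)"
    have "(3::int) ^ t dvd int k" unfolding t_def by (rule multiplicity_dvd)
    then have "(3::int) ^ t \<le> int k" using k by (intro zdvd_imp_le) auto
    then have "(3::int) ^ t < 3 ^ (k - 1)" using \<open>k < 3 ^ (k - 1)\<close>
      by (metis le_less_trans of_nat_less_iff of_nat_numeral of_nat_power)
    then have t: "t + 2 \<le> k" using k by simp
    have "3 ^ v dvd int n * int ((n - 1) choose (k - 1))"
      unfolding v_def by (intro dvd_mult2 multiplicity_dvd)
    also have "int n * int ((n - 1) choose (k - 1)) = int k * int (n choose k)"
      using times_binomial_minus1_eq[of k n] k by (metis of_nat_mult not_numeral_le_zero gr0I)
    finally have "v \<le> multiplicity 3 (int k * int (n choose k)) \<or> n choose k = 0"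
      using k by (cases "n choose k = 0") (auto intro: multiplicity_geI)
    moreover have "multiplicity 3 (int k * int (n choose k)) = t + multiplicity 3 (int (n choose k))" if "n choose k \<noteq> 0"
      unfolding t_def using k that by (intro prime_elem_multiplicity_mult_distrib) auto
    ultimately have "v \<le> t + multiplicity 3 (int (n choose k)) \<or> n choose k = 0" by auto
    moreover have "3 ^ multiplicity 3 (int (n choose k)) dvd int (n choose k)" by (rule multiplicity_dvd)
    ultimately have "(3::int) ^ (v - t) dvd int (n choose k)"
      by (cases "n choose k = 0", metis dvd_0_right of_nat_0) (auto intro!: multiplicity_dvd')
    then have A: "(3 ^ (v - t) * 3 ^ k) * x\<^sup>2 dvd int (n choose k) * (3 ^ k * x ^ k)"
      unfolding mult.assoc using k by (intro mult_dvd_mono le_imp_power_dvd) auto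
    have "(3::int) ^ (v + 2) dvd 3 ^ (v - t) * 3 ^ k"
      unfolding power_add[symmetric] using t by (intro le_imp_power_dvd) simp
    then have "3 ^ (v + 2) * x\<^sup>2 dvd (3 ^ (v - t) * 3 ^ k) * x\<^sup>2" by (intro mult_dvd_mono) auto
    from dvd_trans[OF this A] have "3 ^ (v + 2) * x\<^sup>2 dvd int (n choose k) * (3 * x) ^ k"
      by (simp only: power_mult_distrib)
    then show ?thesis by (elim dvdE) blast
  qed
  then obtain c where c: "\<And>k. k \<ge> 2 \<Longrightarrow> int (n choose k) * (3 * x) ^ k = 3 ^ (v + 2) * x\<^sup>2 * c k" by metis
  have "(of_int x - \<theta>) ^ (3 * n) = (\<Sum>k\<le>n. of_int (int (n choose k) * (3 * x) ^ k) * U ^ k)"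
    unfolding power_mult cube by (subst binomial_ring) (simp add: power_mult_distrib mult_ac)
  also have "{..n} = {0,1} \<union> {2..n}" using n by auto
  also have "(\<Sum>k\<in>{0,1} \<union> {2..n}. of_int (int (n choose k) * (3 * x) ^ k) * U ^ k) = 
     1 + of_int (int n * (3 * x)) * U + (\<Sum>k=2..n. of_int (int (n choose k) * (3 * x) ^ k) * U ^ k)"
    by (subst sum.union_disjoint) auto
  also have "(\<Sum>k=2..n. of_int (int (n choose k) * (3 * x) ^ k) * U ^ k) = 
     of_int (3 ^ (v + 2) * x\<^sup>2) * (\<Sum>k=2..n. of_int (c k) * U ^ k)"
    unfolding sum_distrib_left
  proof (intro sum.cong refl)
    fix k assume "k \<in> {2..n}"
    then have "k \<ge> 2" by simp
    show "of_int (int (n choose k) * (3 * x) ^ k) * U ^ k = of_int (3 ^ (v + 2) * x\<^sup>2) * (of_int (c k) * U ^ k)"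
      unfolding c[OF \<open>k \<ge> 2\<close>] by (simp add: mult.assoc)
  qed
  finally have expand: "(of_int x - \<theta>) ^ (3 * n) = 1 + of_int (int n * (3 * x)) * U + 
     of_int (3 ^ (v + 2) * x\<^sup>2) * (\<Sum>k=2..n. of_int (c k) * U ^ k)" .
  have "(\<Sum>k=2..n. of_int (c k) * U ^ k) \<in> cubic_ring \<theta>"
    by (intro cubic_ring_sum cubic_ring_mult[OF \<theta>] cubic_ring_power[OF \<theta>] U cubic_ring_of_int)
  then obtain w0 w1 w2 where W: "(\<Sum>k=2..n. of_int (c k) * U ^ k) = of_int w0 + of_int w1 * \<theta> + of_int w2 * \<theta>\<^sup>2"
    by (rule cubic_ringE)
  show ?thesis
    by (rule that[of "1 + 3 ^ (v + 2) * x\<^sup>2 * w0" w1 "x * w2"], unfold expand W)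
      (simp add: U_def algebra_simps power2_eq_square)
qed

text \<open>The part of \<open>n\<close> prime to 3 is shifted by a multiple of 3. Hence the
  coordinates in \<open>unit_power_cubed\<close> have the valuation of their leading terms.\<close>

lemma multiplicity_3_perturb:
  assumes "n \<noteq> (0::int)"
  shows "n + 3 ^ (multiplicity 3 n + 1) * W \<noteq> 0" "multiplicity 3 (n + 3 ^ (multiplicity 3 n + 1) * W) = multiplicity 3 n"
proof -
  obtain u where u: "n = 3 ^ multiplicity 3 n * u" "\<not> 3 dvd u"
    using multiplicity_decompose'[OF assms, of 3] by auto
  have e: "n + 3 ^ (multiplicity 3 n + 1) * W = 3 ^ multiplicity 3 n * (u + 3 * W)"
    by (subst u(1)) (simp add: algebra_simps)
  have nd: "\<not> 3 dvd u + 3 * W" using u(2) by presburger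
  show "n + 3 ^ (multiplicity 3 n + 1) * W \<noteq> 0" unfolding e using nd by auto
  show "multiplicity 3 (n + 3 ^ (multiplicity 3 n + 1) * W) = multiplicity 3 n"
    by (rule multiplicity_decomposeI[OF e nd]) simp
qed

section \<open>A multiplicative relation between the two units\<close>

text \<open>Elements \<open>e0 + e1 + e2\<close> are graded by \<open>\<int>/3\<close>; the cubic form below is their norm, and it is
  multiplicative for the cyclic convolution.\<close>

definition graded_unit :: "int \<Rightarrow> real \<Rightarrow> real \<Rightarrow> int \<Rightarrow> real \<Rightarrow> real \<Rightarrow> bool" where
  "graded_unit Z \<alpha> \<beta> e0 e1 e2 \<longleftrightarrow>
     (\<exists>q r s t :: int. e1 = of_int q * \<alpha> + of_int t * \<beta>\<^sup>2 \<and> e2 = of_int s * \<alpha>\<^sup>2 + of_int r * \<beta>) \<and>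
     of_int e0 ^ 3 + e1 ^ 3 + e2 ^ 3 - 3 * of_int e0 * e1 * e2 = 1"

text \<open>A pigeonhole argument in place of the unit theorem. With \<eta>
  \<open>= X - \<alpha> < 1\<close> and \<zeta> the inverse of \<open>Y - \<beta>\<close>, each
  power of \<eta> is brought into \<open>[1, \<zeta>]\<close> by a power of \<zeta>. Norm 1 then
  bounds all components, so two of these products coincide.\<close>

lemma unit_relation:
  fixes X Y Z :: int and \<alpha> \<beta> :: real
  assumes XY: "X > 1" "Y > 1" and \<alpha>: "\<alpha> > 0" "\<alpha> ^ 3 = of_int (X ^ 3 - 1)"
    and \<beta>: "\<beta> > 0" "\<beta> ^ 3 = of_int (Y ^ 3 - 1)" and Z: "\<alpha> * \<beta> = of_int Z"
  shows "\<exists>n>0. \<exists>m>0. (of_int X - \<alpha>) ^ n = (of_int Y - \<beta>) ^ m"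
proof -
  define a where "a = X ^ 3 - 1"
  define b where "b = Y ^ 3 - 1"
  have a_pos: "a > 0" using XY one_less_power[of X 3] by (simp add: a_def)
  have small: "0 < of_int x - \<theta> \<and> of_int x - \<theta> < 1 \<and> ((of_int x)\<^sup>2 + of_int x * \<theta> + \<theta>\<^sup>2) * (of_int x - \<theta>) = 1"
    if "x > 1" "\<theta> > 0" "\<theta> ^ 3 = of_int (x ^ 3 - 1)" for x :: int and \<theta> :: real
  proof -
    have e: "((of_int x)\<^sup>2 + of_int x * \<theta> + \<theta>\<^sup>2) * (of_int x - \<theta>) = 1"
      using that(3) by (simp add: algebra_simps power2_eq_square power3_eq_cube)
    have "1 < real_of_int x" using that by simp
    then have "1 < (real_of_int x)\<^sup>2" by (intro one_less_power) auto
    moreover have "of_int x * \<theta> > 0" "\<theta>\<^sup>2 > 0" using that by auto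
    ultimately have g: "(of_int x)\<^sup>2 + of_int x * \<theta> + \<theta>\<^sup>2 > 1" by linarith
    have "of_int x - \<theta> = 1 / ((of_int x)\<^sup>2 + of_int x * \<theta> + \<theta>\<^sup>2)" using e g by (simp add: field_simps)
    then show ?thesis using e g by simp
  qed
  define \<eta> where "\<eta> = of_int X - \<alpha>"
  define \<zeta> where "\<zeta> = (of_int Y)\<^sup>2 + of_int Y * \<beta> + \<beta>\<^sup>2"
  have \<eta>: "0 < \<eta>" "\<eta> < 1" using small[OF XY(1) \<alpha>] by (auto simp: \<eta>_def)
  have \<epsilon>: "0 < of_int Y - \<beta>" "of_int Y - \<beta> < 1" "\<zeta> * (of_int Y - \<beta>) = 1" using small[OF XY(2) \<beta>] by (auto simp: \<zeta>_def)
  have "\<zeta> = 1 / (of_int Y - \<beta>)" using \<epsilon> by (simp add: field_simps)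
  then have \<zeta>: "\<zeta> > 1" using \<epsilon> by simp
  have \<alpha>3: "\<alpha> * (\<alpha> * \<alpha>) = of_int a" using \<alpha>(2) by (simp add: a_def power3_eq_cube mult.assoc)
  have \<beta>3: "\<beta> * (\<beta> * \<beta>) = of_int b" using \<beta>(2) by (simp add: b_def power3_eq_cube mult.assoc)

  \<comment> \<open>Convolution with \<open>(X, - \<alpha>, 0)\<close>, of norm
    \<open>X^3 - \<alpha>^3 = 1\<close>. With \<alpha> in degree 1 and \<beta> in degree 2 the
    grading is consistent with \<open>\<alpha> * \<beta> = Z\<close>.\<close>
  have step1: "\<exists>f0 f1 f2. graded_unit Z \<alpha> \<beta> f0 f1 f2 \<and> of_int f0 + f1 + f2 = (of_int e0 + e1 + e2) * \<eta>"
    if "graded_unit Z \<alpha> \<beta> e0 e1 e2" for e0 e1 e2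
  proof -
    from that obtain q r s t :: int where e: "e1 = of_int q * \<alpha> + of_int t * \<beta>\<^sup>2" "e2 = of_int s * \<alpha>\<^sup>2 + of_int r * \<beta>"
      and N: "of_int e0 ^ 3 + e1 ^ 3 + e2 ^ 3 - 3 * of_int e0 * e1 * e2 = 1"
      unfolding graded_unit_def by blast
    define f0 where "f0 = e0 * X - (s * a + r * Z)"
    define f1 where "f1 = e1 * of_int X - of_int e0 * \<alpha>"
    define f2 where "f2 = e2 * of_int X - e1 * \<alpha>"
    have f0: "of_int f0 = of_int e0 * of_int X - e2 * \<alpha>"
      by (simp add: f0_def e Z[symmetric] \<alpha>3[symmetric] power2_eq_square algebra_simps)
    have f1: "f1 = of_int (q * X - e0) * \<alpha> + of_int (t * X) * \<beta>\<^sup>2"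
      by (simp add: f1_def e algebra_simps)
    have "e1 * \<alpha> = of_int q * \<alpha>\<^sup>2 + of_int t * (\<alpha> * \<beta>) * \<beta>" by (simp add: e power2_eq_square algebra_simps)
    then have f2: "f2 = of_int (s * X - q) * \<alpha>\<^sup>2 + of_int (r * X - t * Z) * \<beta>"
      unfolding Z by (simp add: f2_def e algebra_simps)
    have "of_int f0 ^ 3 + f1 ^ 3 + f2 ^ 3 - 3 * of_int f0 * f1 * f2 =
       (of_int e0 ^ 3 + e1 ^ 3 + e2 ^ 3 - 3 * of_int e0 * e1 * e2) * (of_int X ^ 3 - \<alpha> ^ 3)"
      unfolding f0 f1_def f2_def by algebra
    also have "\<dots> = 1" using N \<alpha>(2) by simp
    finally have "graded_unit Z \<alpha> \<beta> f0 f1 f2" unfolding graded_unit_def using f1 f2 by blast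
    moreover have "of_int f0 + f1 + f2 = (of_int e0 + e1 + e2) * \<eta>"
      unfolding f0 f1_def f2_def \<eta>_def by (simp add: algebra_simps)
    ultimately show ?thesis by blast
  qed
  \<comment> \<open>Convolution with \<open>(Y^2, \<beta>^2, Y \<beta>)\<close>, of norm
    \<open>(Y^3 - \<beta>^3)^2 = 1\<close>.\<close>
  have step2: "\<exists>f0 f1 f2. graded_unit Z \<alpha> \<beta> f0 f1 f2 \<and> of_int f0 + f1 + f2 = (of_int e0 + e1 + e2) * \<zeta>"
    if "graded_unit Z \<alpha> \<beta> e0 e1 e2" for e0 e1 e2
  proof -
    from that obtain q r s t :: int where e: "e1 = of_int q * \<alpha> + of_int t * \<beta>\<^sup>2" "e2 = of_int s * \<alpha>\<^sup>2 + of_int r * \<beta>"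
      and N: "of_int e0 ^ 3 + e1 ^ 3 + e2 ^ 3 - 3 * of_int e0 * e1 * e2 = 1"
      unfolding graded_unit_def by blast
    have p: "e1 * \<beta> = of_int (q * Z + t * b)" "e2 * \<beta>\<^sup>2 = of_int (s * Z\<^sup>2 + r * b)"
      "e2 * \<beta> = of_int (s * Z) * \<alpha> + of_int r * \<beta>\<^sup>2" "e1 * \<beta>\<^sup>2 = of_int (q * Z + t * b) * \<beta>"
      unfolding e of_int_add of_int_mult of_int_power Z[symmetric] \<beta>3[symmetric]
      by (simp_all add: power2_eq_square algebra_simps)
    define f0 where "f0 = e0 * Y\<^sup>2 + (q * Z + t * b) * Y + (s * Z\<^sup>2 + r * b)"
    define f1 where "f1 = of_int e0 * \<beta>\<^sup>2 + e1 * (of_int Y)\<^sup>2 + e2 * \<beta> * of_int Y"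
    define f2 where "f2 = of_int e0 * \<beta> * of_int Y + e1 * \<beta>\<^sup>2 + e2 * (of_int Y)\<^sup>2"
    have f0: "of_int f0 = of_int e0 * (of_int Y)\<^sup>2 + e1 * \<beta> * of_int Y + e2 * \<beta>\<^sup>2"
      unfolding p by (simp add: f0_def)
    have f1: "f1 = of_int (q * Y\<^sup>2 + s * Z * Y) * \<alpha> + of_int (e0 + t * Y\<^sup>2 + r * Y) * \<beta>\<^sup>2"
      unfolding f1_def p by (simp add: e algebra_simps)
    have f2: "f2 = of_int (s * Y\<^sup>2) * \<alpha>\<^sup>2 + of_int (e0 * Y + (q * Z + t * b) + r * Y\<^sup>2) * \<beta>"
      unfolding f2_def p by (simp add: e algebra_simps)
    have "of_int f0 ^ 3 + f1 ^ 3 + f2 ^ 3 - 3 * of_int f0 * f1 * f2 =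
       (of_int e0 ^ 3 + e1 ^ 3 + e2 ^ 3 - 3 * of_int e0 * e1 * e2) * (of_int Y ^ 3 - \<beta> ^ 3)\<^sup>2"
      unfolding f0 f1_def f2_def by algebra
    also have "\<dots> = 1" using N \<beta>(2) by simp
    finally have "graded_unit Z \<alpha> \<beta> f0 f1 f2" unfolding graded_unit_def using f1 f2 by blast
    moreover have "of_int f0 + f1 + f2 = (of_int e0 + e1 + e2) * \<zeta>"
      unfolding f0 f1_def f2_def \<zeta>_def by (simp add: algebra_simps power2_eq_square)
    ultimately show ?thesis by blast
  qed
  have one: "graded_unit Z \<alpha> \<beta> 1 0 0" unfolding graded_unit_def by (auto intro!: exI[of _ 0])
  have pow1: "\<exists>e0 e1 e2. graded_unit Z \<alpha> \<beta> e0 e1 e2 \<and> of_int e0 + e1 + e2 = \<eta> ^ i" for i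
  proof (induction i)
    case 0
    then show ?case using one by (intro exI[of _ 1] exI[of _ 0]) simp
  next
    case (Suc i)
    then obtain e0 e1 e2 where e: "graded_unit Z \<alpha> \<beta> e0 e1 e2" "of_int e0 + e1 + e2 = \<eta> ^ i" by blast
    show ?case using step1[OF e(1)] unfolding e(2) by (simp add: mult.commute)
  qed
  have pow2: "\<exists>e0 e1 e2. graded_unit Z \<alpha> \<beta> e0 e1 e2 \<and> of_int e0 + e1 + e2 = \<eta> ^ i * \<zeta> ^ j" for i j
  proof (induction j)
    case 0
    then show ?case using pow1[of i] by simp
  next
    case (Suc j)
    then obtain e0 e1 e2 where e: "graded_unit Z \<alpha> \<beta> e0 e1 e2" "of_int e0 + e1 + e2 = \<eta> ^ i * \<zeta> ^ j" by blast
    show ?case using step2[OF e(1)] unfolding e(2) by (simp add: mult_ac)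
  qed
  have "\<exists>j. 1 \<le> \<eta> ^ i * \<zeta> ^ j \<and> \<eta> ^ i * \<zeta> ^ j \<le> \<zeta>" for i
  proof -
    obtain j0 where "1 / \<eta> ^ i < \<zeta> ^ j0" using real_arch_pow[OF \<zeta>] by blast
    then have ex: "\<exists>j. 1 \<le> \<eta> ^ i * \<zeta> ^ j" using \<eta> by (intro exI[of _ j0]) (simp add: field_simps)
    define j where "j = (LEAST j. 1 \<le> \<eta> ^ i * \<zeta> ^ j)"
    have j: "1 \<le> \<eta> ^ i * \<zeta> ^ j" unfolding j_def using ex by (rule LeastI_ex)
    moreover have "\<eta> ^ i * \<zeta> ^ j \<le> \<zeta>"
    proof (cases j)
      case 0
      have "\<eta> ^ i \<le> 1" using \<eta> by (intro power_le_one) auto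
      then show ?thesis using 0 \<zeta> by simp
    next
      case (Suc k)
      have "\<not> 1 \<le> \<eta> ^ i * \<zeta> ^ k" using not_less_Least[of k "\<lambda>j. 1 \<le> \<eta> ^ i * \<zeta> ^ j"] Suc unfolding j_def by simp
      then have "\<eta> ^ i * \<zeta> ^ k * \<zeta> \<le> 1 * \<zeta>" using \<zeta> by (intro mult_right_mono) auto
      then show ?thesis using Suc by (simp add: mult_ac)
    qed
    ultimately show ?thesis by blast
  qed
  then obtain j where j: "\<And>i. 1 \<le> \<eta> ^ i * \<zeta> ^ j i" "\<And>i. \<eta> ^ i * \<zeta> ^ j i \<le> \<zeta>" by metis

  \<comment> \<open>Since \<open>a \<beta> = Z \<alpha>^2\<close> and
    \<open>a \<beta>^2 = Z^2 \<alpha>\<close>, all products have integer coordinates over the common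
    denominator \<open>a\<close>, bounded independently of \<open>i\<close>.\<close>
  define B where "B = \<lceil>\<zeta> + 2\<rceil>"
  define C where "C = \<lceil>of_int a * (\<zeta> + 2) / \<alpha>\<rceil>"
  define D where "D = \<lceil>of_int a * (\<zeta> + 2) / \<alpha>\<^sup>2\<rceil>"
  have "\<exists>p k l. \<bar>p\<bar> \<le> B \<and> \<bar>k\<bar> \<le> C \<and> \<bar>l\<bar> \<le> D \<and>
      \<eta> ^ i * \<zeta> ^ j i = of_int p + of_int k * \<alpha> / of_int a + of_int l * \<alpha>\<^sup>2 / of_int a" for i
  proof -
    obtain e0 e1 e2 where e: "graded_unit Z \<alpha> \<beta> e0 e1 e2" "of_int e0 + e1 + e2 = \<eta> ^ i * \<zeta> ^ j i" using pow2 by blast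
    then obtain q r s t :: int where e12: "e1 = of_int q * \<alpha> + of_int t * \<beta>\<^sup>2" "e2 = of_int s * \<alpha>\<^sup>2 + of_int r * \<beta>"
      and N: "of_int e0 ^ 3 + e1 ^ 3 + e2 ^ 3 - 3 * of_int e0 * e1 * e2 = 1"
      unfolding graded_unit_def by blast
    define S where "S = of_int e0 + e1 + e2"
    \<comment> \<open>The norm factors as \<open>S * Q\<close>. As \<open>S \<ge> 1\<close> forces
      \<open>Q \<le> 1\<close>, the components differ pairwise by at most 2, and their sum
      \<open>S\<close> is at most \<zeta>.\<close>
    define Q where "Q = ((of_int e0 - e1)\<^sup>2 + (e1 - e2)\<^sup>2 + (e2 - of_int e0)\<^sup>2) / 2"
    have S: "1 \<le> S" "S \<le> \<zeta>" using j[of i] e(2) by (auto simp: S_def)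
    have "S * Q = 1" unfolding S_def Q_def N[symmetric] by (simp add: field_simps power2_eq_square power3_eq_cube)
    have "Q \<le> 1"
    proof (rule ccontr)
      assume "\<not> Q \<le> 1"
      then have "1 * 1 < S * Q" using S by (intro mult_le_less_imp_less) auto
      then show False using \<open>S * Q = 1\<close> by simp
    qed
    then have sum2: "(of_int e0 - e1)\<^sup>2 + (e1 - e2)\<^sup>2 + (e2 - of_int e0)\<^sup>2 \<le> 2" unfolding Q_def by simp
    have d: "\<bar>x\<bar> \<le> 2" if "x\<^sup>2 \<le> 2" for x :: real
      using that abs_le_square_iff[of x 2] by simp
    have "(of_int e0 - e1)\<^sup>2 \<le> 2" "(e1 - e2)\<^sup>2 \<le> 2" "(e2 - of_int e0)\<^sup>2 \<le> 2"
      using sum2 by (smt (verit) zero_le_power2)+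
    then have "\<bar>of_int e0 - e1\<bar> \<le> 2" "\<bar>e1 - e2\<bar> \<le> 2" "\<bar>e2 - of_int e0\<bar> \<le> 2" by (auto dest!: d)
    then have bd: "\<bar>of_int e0\<bar> \<le> \<zeta> + 2" "\<bar>e1\<bar> \<le> \<zeta> + 2" "\<bar>e2\<bar> \<le> \<zeta> + 2" using S unfolding S_def by linarith+
    define k where "k = q * a + t * Z\<^sup>2"
    define l where "l = s * a + r * Z"
    have k: "of_int k * \<alpha> = of_int a * e1" and l: "of_int l * \<alpha>\<^sup>2 = of_int a * e2"
      unfolding e12 k_def l_def of_int_add of_int_mult of_int_power Z[symmetric] \<alpha>3[symmetric]
      by (simp_all add: power2_eq_square algebra_simps)
    have ceil: "c \<le> \<lceil>y\<rceil>" if "of_int c \<le> y" for c :: int and y :: real using that by linarith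
    have "of_int \<bar>e0\<bar> \<le> \<zeta> + 2" using bd(1) by simp
    then have "\<bar>e0\<bar> \<le> B" unfolding B_def by (rule ceil)
    moreover have "\<bar>of_int k * \<alpha>\<bar> \<le> of_int a * (\<zeta> + 2)" unfolding k abs_mult using a_pos bd(2) by simp
    then have "of_int \<bar>k\<bar> \<le> of_int a * (\<zeta> + 2) / \<alpha>" using \<alpha>(1) by (simp add: abs_mult field_simps)
    then have "\<bar>k\<bar> \<le> C" unfolding C_def by (rule ceil)
    moreover have "\<bar>of_int l * \<alpha>\<^sup>2\<bar> \<le> of_int a * (\<zeta> + 2)" unfolding l abs_mult using a_pos bd(3) by simp
    then have "of_int \<bar>l\<bar> \<le> of_int a * (\<zeta> + 2) / \<alpha>\<^sup>2" using \<alpha>(1) by (simp add: abs_mult field_simps)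
    then have "\<bar>l\<bar> \<le> D" unfolding D_def by (rule ceil)
    moreover have "\<eta> ^ i * \<zeta> ^ j i = of_int e0 + of_int k * \<alpha> / of_int a + of_int l * \<alpha>\<^sup>2 / of_int a"
      unfolding k l e(2)[symmetric] using a_pos by simp
    ultimately show ?thesis by blast
  qed
  note coords = this
  have "range (\<lambda>i. \<eta> ^ i * \<zeta> ^ j i) \<subseteq>
      (\<lambda>(p, k, l). of_int p + of_int k * \<alpha> / of_int a + of_int l * \<alpha>\<^sup>2 / of_int a) ` ({-B..B} \<times> {-C..C} \<times> {-D..D})"
  proof (rule image_subsetI)
    fix i
    obtain p k l where "\<bar>p\<bar> \<le> B" "\<bar>k\<bar> \<le> C" "\<bar>l\<bar> \<le> D"
      "\<eta> ^ i * \<zeta> ^ j i = of_int p + of_int k * \<alpha> / of_int a + of_int l * \<alpha>\<^sup>2 / of_int a" using coords[of i] by blast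
    then show "\<eta> ^ i * \<zeta> ^ j i \<in> (\<lambda>(p, k, l). of_int p + of_int k * \<alpha> / of_int a + of_int l * \<alpha>\<^sup>2 / of_int a) `
        ({-B..B} \<times> {-C..C} \<times> {-D..D})"
      by (intro image_eqI[of _ _ "(p, k, l)"]) auto
  qed
  then have "finite (range (\<lambda>i. \<eta> ^ i * \<zeta> ^ j i))" by (rule finite_subset) auto
  then have "\<not> inj (\<lambda>i. \<eta> ^ i * \<zeta> ^ j i)" using finite_imageD infinite_UNIV_nat by blast
  then obtain i i' where ii: "i < i'" "\<eta> ^ i * \<zeta> ^ j i = \<eta> ^ i' * \<zeta> ^ j i'"
    using linorder_injI[of "\<lambda>i. \<eta> ^ i * \<zeta> ^ j i"] by blast
  define n where "n = i' - i"
  have "\<eta> ^ i' = \<eta> ^ n * \<eta> ^ i" using ii by (simp add: n_def flip: power_add)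
  then have eq: "\<zeta> ^ j i = \<eta> ^ n * \<zeta> ^ j i'" using ii(2) \<eta> by simp
  have n: "n > 0" using ii by (simp add: n_def)
  \<comment> \<open>This makes the exponent of \<zeta> strictly larger at \<open>i'\<close>, so that
    \<open>m\<close> is positive.\<close>
  have "\<eta> ^ n < 1" using \<eta> n by (simp add: power_less_one_iff)
  then have "\<zeta> ^ j i < 1 * \<zeta> ^ j i'" unfolding eq using \<zeta> by (intro mult_strict_right_mono) auto
  then have jj: "j i < j i'" using \<zeta> by simp
  define m where "m = j i' - j i"
  have "\<zeta> ^ j i' = \<zeta> ^ m * \<zeta> ^ j i" using jj by (simp add: m_def flip: power_add)
  then have "\<eta> ^ n * \<zeta> ^ m = 1" using eq \<zeta> by (simp add: mult.commute)
  then have "\<eta> ^ n * (\<zeta> ^ m * (of_int Y - \<beta>) ^ m) = (of_int Y - \<beta>) ^ m" by (simp add: mult.assoc[symmetric])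
  then have "\<eta> ^ n = (of_int Y - \<beta>) ^ m" by (simp add: \<epsilon>(3) flip: power_mult_distrib)
  then show ?thesis unfolding \<eta>_def using n jj by (intro exI[of _ n] exI[of _ m] conjI) (auto simp: m_def)
qed

section \<open>Exponent 3\<close>

lemma cube_root_less:
  fixes x :: int and \<theta> :: real
  assumes "x > 1" "\<theta> ^ 3 = of_int (x ^ 3 - 1)"
  shows "\<theta> < of_int x"
  using assms by (intro power_less_imp_less_base[of \<theta> 3]) auto

section \<open>Comparison of coordinates and their valuations\<close>

text \<open>The cube roots are parameters, so that a second interpretation can exchange the roles of
  \<open>X\<close> and \<open>Y\<close>.\<close>

locale cubic_solution =
  fixes X Y Z :: int and \<alpha> \<beta> :: real
  assumes XY: "X > 1" "Y > 1" and Z: "Z > 0" and eq: "(X ^ 3 - 1) * (Y ^ 3 - 1) = Z ^ 3"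
    and \<alpha>: "\<alpha> > 0" "\<alpha> ^ 3 = of_int (X ^ 3 - 1)"
    and \<beta>: "\<beta> > 0" "\<beta> ^ 3 = of_int (Y ^ 3 - 1)"
    and \<alpha>\<beta>: "\<alpha> * \<beta> = of_int Z"
begin

text \<open>Multiplication by \<open>a = X^3 - 1\<close> rewrites the right-hand side in powers of
  \<alpha>, by \<open>a \<beta> = Z \<alpha>^2\<close> and
  \<open>a \<beta>^2 = Z^2 \<alpha>\<close>; then independence applies.\<close>

lemma coordinates_relation:
  assumes "of_int A0 + of_int A1 * \<alpha> + of_int A2 * \<alpha>\<^sup>2 = of_int B0 + of_int B1 * \<beta> + of_int B2 * \<beta>\<^sup>2"
  shows "A0 = B0" "(X ^ 3 - 1) * A1 = Z\<^sup>2 * B2" "(X ^ 3 - 1) * A2 = Z * B1"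
proof -
  have a: "\<alpha> * (\<alpha> * \<alpha>) = of_int (X ^ 3 - 1)" using \<alpha>(2) by (simp add: power3_eq_cube mult.assoc)
  have a1: "of_int (X ^ 3 - 1) * \<beta> = of_int Z * \<alpha>\<^sup>2"
    and a2: "of_int (X ^ 3 - 1) * \<beta>\<^sup>2 = of_int (Z\<^sup>2) * \<alpha>"
    unfolding a[symmetric] of_int_power \<alpha>\<beta>[symmetric] by (simp_all add: power2_eq_square mult_ac)
  have "of_int (X ^ 3 - 1) * (of_int A0 + of_int A1 * \<alpha> + of_int A2 * \<alpha>\<^sup>2) =
      of_int (X ^ 3 - 1) * of_int B0 + of_int B1 * (of_int (X ^ 3 - 1) * \<beta>) + of_int B2 * (of_int (X ^ 3 - 1) * \<beta>\<^sup>2)"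
    unfolding assms by (simp add: algebra_simps)
  then have "of_int ((X ^ 3 - 1) * (A0 - B0)) + of_int ((X ^ 3 - 1) * A1 - Z\<^sup>2 * B2) * \<alpha>
      + of_int ((X ^ 3 - 1) * A2 - Z * B1) * \<alpha>\<^sup>2 = 0"
    unfolding a1 a2 by (simp add: algebra_simps)
  note * = cubic_independent[OF \<alpha>(2) unit_cube_root_irrational[OF XY(1) \<alpha>(2,1)] this]
  have "X ^ 3 - 1 > 0" using XY one_less_power[of X 3] by simp
  then show "A0 = B0" "(X ^ 3 - 1) * A1 = Z\<^sup>2 * B2" "(X ^ 3 - 1) * A2 = Z * B1" using * by auto
qed

text \<open>Cubing the relation makes \<open>unit_power_cubed\<close> applicable to both sides. Each
  non-constant coordinate has a known valuation, so the last two coordinate equations become the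
  linear equations \<open>E1\<close> and \<open>E2\<close>; their difference is the first claim, and
  \<open>E1\<close> is the second.\<close>

lemma valuation_relations:
  assumes rel: "(of_int X - \<alpha>) ^ n = (of_int Y - \<beta>) ^ m" and n: "n > 0" "m > 0"
  shows "multiplicity 3 Z = multiplicity 3 X + multiplicity 3 Y"
    "multiplicity 3 (X ^ 3 - 1) + multiplicity 3 (int n) + 2 * multiplicity 3 X =
     2 * multiplicity 3 Z + multiplicity 3 (int m) + multiplicity 3 Y"
proof -
  define v where "v = multiplicity 3 (int n)"
  define u where "u = multiplicity 3 (int m)"
  obtain W0 W1 W2 where W: "(of_int X - \<alpha>) ^ (3 * n) = of_int W0 +
      of_int (3 * X\<^sup>2 * (3 ^ (v + 1) * W1 - int n)) * \<alpha> + of_int (3 * X * (int n + 3 ^ (v + 1) * W2)) * \<alpha>\<^sup>2"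
    unfolding v_def by (rule unit_power_cubed[OF \<alpha>(2) n(1)])
  obtain V0 V1 V2 where V: "(of_int Y - \<beta>) ^ (3 * m) = of_int V0 +
      of_int (3 * Y\<^sup>2 * (3 ^ (u + 1) * V1 - int m)) * \<beta> + of_int (3 * Y * (int m + 3 ^ (u + 1) * V2)) * \<beta>\<^sup>2"
    unfolding u_def by (rule unit_power_cubed[OF \<beta>(2) n(2)])
  have "(of_int X - \<alpha>) ^ (3 * n) = (of_int Y - \<beta>) ^ (3 * m)"
    using rel by (metis mult.commute power_mult)
  note R = coordinates_relation[OF this[unfolded W V]]
  have pe: "prime_elem (3::int)" by simp
  note M = prime_elem_multiplicity_mult_distrib[OF pe]
  have nz: "X \<noteq> 0" "Y \<noteq> 0" "Z \<noteq> 0" using XY Z by auto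
  have "X ^ 3 - 1 > 0" using XY one_less_power[of X 3] by simp
  then have anz: "X ^ 3 - 1 \<noteq> 0" by simp
  have pert1: "k + 3 ^ (multiplicity 3 k + 1) * W \<noteq> 0 \<and> multiplicity 3 (k + 3 ^ (multiplicity 3 k + 1) * W) = multiplicity 3 k"
    if "k \<noteq> 0" for k W :: int using multiplicity_3_perturb[OF that] by blast
  have pert2: "3 ^ (multiplicity 3 k + 1) * W - k \<noteq> 0 \<and> multiplicity 3 (3 ^ (multiplicity 3 k + 1) * W - k) = multiplicity 3 k"
    if "k \<noteq> 0" for k W :: int
    using pert1[of "- k" W] that multiplicity_times_unit_right[of "-1" 3 k] by (simp add: algebra_simps)
  have coord2: "3 * x * (k + 3 ^ (multiplicity 3 k + 1) * W) \<noteq> 0 \<and> 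
      multiplicity 3 (3 * x * (k + 3 ^ (multiplicity 3 k + 1) * W)) = 1 + multiplicity 3 x + multiplicity 3 k"
    if "k \<noteq> 0" "x \<noteq> 0" for k x W :: int
    using pert1[OF that(1), of W] that(2) M[of 3 x] M[of "3 * x" "k + 3 ^ (multiplicity 3 k + 1) * W"] by simp
  have coord1: "3 * x\<^sup>2 * (3 ^ (multiplicity 3 k + 1) * W - k) \<noteq> 0 \<and> 
      multiplicity 3 (3 * x\<^sup>2 * (3 ^ (multiplicity 3 k + 1) * W - k)) = 1 + 2 * multiplicity 3 x + multiplicity 3 k"
    if "k \<noteq> 0" "x \<noteq> 0" for k x W :: int
    using pert2[OF that(1), of W] that(2) M[of x x] M[of 3 "x\<^sup>2"] M[of "3 * x\<^sup>2" "3 ^ (multiplicity 3 k + 1) * W - k"]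
    by (simp add: power2_eq_square)
  have n0: "int n \<noteq> 0" "int m \<noteq> 0" using n by auto
  note A1 = coord1[OF n0(1) nz(1), folded v_def, of W1] and A2 = coord2[OF n0(1) nz(1), folded v_def, of W2]
    and B1 = coord1[OF n0(2) nz(2), folded u_def, of V1] and B2 = coord2[OF n0(2) nz(2), folded u_def, of V2]
  have E1: "multiplicity 3 (X ^ 3 - 1) + (1 + 2 * multiplicity 3 X + v) = 2 * multiplicity 3 Z + (1 + multiplicity 3 Y + u)"
    using arg_cong[OF R(2), of "multiplicity 3"] A1 B2 M[OF anz, of "3 * X\<^sup>2 * (3 ^ (v + 1) * W1 - int n)"] M[of "Z\<^sup>2" "3 * Y * (int m + 3 ^ (u + 1) * V2)"]
       M[OF nz(3) nz(3)] nz(3) by (simp only: power2_eq_square mult_eq_0_iff) simp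
  have E2: "multiplicity 3 (X ^ 3 - 1) + (1 + multiplicity 3 X + v) = multiplicity 3 Z + (1 + 2 * multiplicity 3 Y + u)"
    using arg_cong[OF R(3), of "multiplicity 3"] A2 B1 M[OF anz, of "3 * X * (int n + 3 ^ (v + 1) * W2)"] M[OF nz(3), of "3 * Y\<^sup>2 * (3 ^ (u + 1) * V1 - int m)"]
    by simp
  show "multiplicity 3 Z = multiplicity 3 X + multiplicity 3 Y" using E1 E2 by linarith
  show "multiplicity 3 (X ^ 3 - 1) + multiplicity 3 (int n) + 2 * multiplicity 3 X =
     2 * multiplicity 3 Z + multiplicity 3 (int m) + multiplicity 3 Y"
    using E1 unfolding v_def u_def by linarith
qed

section \<open>Descent for residues 1 and 0 modulo 3\<close>

lemma no_solution_1_0_mod_3: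
  assumes mod: "X mod 3 = 1" "3 dvd Y"
  shows False
proof -
  have a3: "3 dvd X ^ 3 - 1" 
  proof -
    have "X ^ 3 - 1 = (X - 1) * (X\<^sup>2 + X + 1)" by (simp add: algebra_simps power2_eq_square power3_eq_cube)
    moreover have "3 dvd X - 1" using mod(1) by presburger
    ultimately show ?thesis by simp
  qed
  have nd: "\<not> 3 dvd Y ^ 3 - 1" 
  proof
    assume "3 dvd Y ^ 3 - 1"
    moreover have "3 dvd Y ^ 3" using mod(2) by (simp add: dvd_power dvd_trans)
    ultimately have "(3::int) dvd 1" by (metis dvd_diff_right_iff)
    then show False by simp
  qed
  have pe: "prime_elem (3::int)" by simp
  have "X ^ 3 - 1 > 0" using XY one_less_power[of X 3] by simp
  then have anz: "X ^ 3 - 1 \<noteq> 0" by simp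
  have "multiplicity 3 (Z ^ 3) = multiplicity 3 ((Y ^ 3 - 1) * (X ^ 3 - 1))" unfolding eq[symmetric] by (simp add: mult.commute)
  also have "\<dots> = multiplicity 3 (X ^ 3 - 1)" by (rule multiplicity_prime_elem_times_other[OF pe nd])
  also have "multiplicity 3 (Z ^ 3) = 3 * multiplicity 3 Z" using Z by (intro prime_elem_multiplicity_power_distrib) auto
  finally have va: "multiplicity 3 (X ^ 3 - 1) = 3 * multiplicity 3 Z" by simp
  have vX: "multiplicity 3 X = 0" using mod(1) by (intro not_dvd_imp_multiplicity_0) presburger
  have descent: "3 dvd n \<and> 3 dvd m" if rel: "(of_int X - \<alpha>) ^ n = (of_int Y - \<beta>) ^ m" and n: "n > 0" "m > 0" for n m
  proof -
    \<comment> \<open>\<open>X^3 - 1\<close> carries the full valuation of \<open>Z^3\<close> and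
      \<open>X\<close> is prime to 3, so both relations together reduce to this equality.\<close>
    have v: "multiplicity 3 (int n) = multiplicity 3 (int m)"
      using valuation_relations[OF rel n] va vX by simp
    have 3: "3 dvd m"
    proof (rule ccontr)
      \<comment> \<open>Constant coordinates are compared modulo 3: on the left it is
        \<open>X^n\<close>, since 3 divides \<open>X^3 - 1\<close>. On the right
        \<open>(Y - \<beta>)^m\<close> is congruent to \<open>(- \<beta>)^m\<close>, which has no
        constant coordinate when 3 does not divide \<open>m\<close>.\<close>
      assume nd3: "\<not> 3 dvd m"
      have "\<exists>e\<in>cubic_ring \<alpha>. (of_int X - \<alpha>) ^ n = of_int (X ^ n) + \<alpha> * e"
      proof (induction n)
        case (Suc n)
        then obtain e where e: "e \<in> cubic_ring \<alpha>" "(of_int X - \<alpha>) ^ n = of_int (X ^ n) + \<alpha> * e" by blast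
        have "(of_int X - \<alpha>) ^ Suc n = of_int (X ^ Suc n) + \<alpha> * ((of_int X - \<alpha>) * e - of_int (X ^ n))"
          by (simp add: e(2) algebra_simps)
        moreover have "(of_int X - \<alpha>) * e - of_int (X ^ n) \<in> cubic_ring \<alpha>"
          by (intro cubic_ring_diff[OF \<alpha>(2)] cubic_ring_mult[OF \<alpha>(2)] e cubic_ring_of_int cubic_ring_generator)
        ultimately show ?case by blast
      qed (use cubic_ring_of_int[of 0] in auto)
      then obtain e where e: "e \<in> cubic_ring \<alpha>" "(of_int X - \<alpha>) ^ n = of_int (X ^ n) + \<alpha> * e" by blast
      obtain e0 e1 e2 where "e = of_int e0 + of_int e1 * \<alpha> + of_int e2 * \<alpha>\<^sup>2" using e(1) by (rule cubic_ringE)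
      then have "\<alpha> * e = \<alpha> ^ 3 * of_int e2 + of_int e0 * \<alpha> + of_int e1 * \<alpha>\<^sup>2"
        by (simp add: algebra_simps power2_eq_square power3_eq_cube)
      then have L: "(of_int X - \<alpha>) ^ n = of_int (X ^ n + (X ^ 3 - 1) * e2) + of_int e0 * \<alpha> + of_int e1 * \<alpha>\<^sup>2"
        unfolding e(2) \<alpha>(2) by simp
      obtain y where y: "Y = 3 * y" using mod(2) by (elim dvdE)
      have "\<exists>f\<in>cubic_ring \<beta>. (of_int Y - \<beta>) ^ m = 3 * f + (- \<beta>) ^ m"
      proof (induction m)
        case (Suc m)
        then obtain f where f: "f \<in> cubic_ring \<beta>" "(of_int Y - \<beta>) ^ m = 3 * f + (- \<beta>) ^ m" by blast
        \<comment> \<open>The base is written \<open>of_int 0 - \<beta>\<close> so that its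
          membership in the order follows from closure under differences.\<close>
        have "(of_int Y - \<beta>) ^ Suc m = 3 * (f * (of_int Y - \<beta>) + (of_int 0 - \<beta>) ^ m * of_int y) + (- \<beta>) ^ Suc m"
          by (simp add: f(2)) (simp add: y algebra_simps)
        moreover have "f * (of_int Y - \<beta>) + (of_int 0 - \<beta>) ^ m * of_int y \<in> cubic_ring \<beta>"
          by (intro cubic_ring_add cubic_ring_power[OF \<beta>(2)] cubic_ring_diff[OF \<beta>(2)] cubic_ring_mult[OF \<beta>(2)] f cubic_ring_of_int cubic_ring_generator)
        ultimately show ?case by blast
      qed (use cubic_ring_of_int[of 0] in auto)
      then obtain f where f: "f \<in> cubic_ring \<beta>" "(of_int Y - \<beta>) ^ m = 3 * f + (- \<beta>) ^ m" by blast
      obtain f0 f1 f2 where fe: "f = of_int f0 + of_int f1 * \<beta> + of_int f2 * \<beta>\<^sup>2" using f(1) by (rule cubic_ringE)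
      have "\<exists>c1 c2 :: int. (- \<beta>) ^ m = of_int c1 * \<beta> + of_int c2 * \<beta>\<^sup>2"
      proof -
        have b3: "(- \<beta>) ^ 3 = of_int (1 - Y ^ 3)" using \<beta>(2) by simp
        define k where "k = m div 3"
        have "m mod 3 = 1 \<or> m mod 3 = 2" using nd3 by presburger
        then have "m = 3 * k + 1 \<or> m = 3 * k + 2" unfolding k_def by presburger
        then show ?thesis
        proof
          assume "m = 3 * k + 1"
          then have "(- \<beta>) ^ m = of_int (- ((1 - Y ^ 3) ^ k)) * \<beta> + of_int 0 * \<beta>\<^sup>2"
            by (simp only: power_add power_mult b3) simp
          then show ?thesis by blast
        next
          assume "m = 3 * k + 2"
          then have "(- \<beta>) ^ m = of_int 0 * \<beta> + of_int ((1 - Y ^ 3) ^ k) * \<beta>\<^sup>2"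
            by (simp only: power_add power_mult b3) simp
          then show ?thesis by blast
        qed
      qed
      then obtain c1 c2 :: int where "(- \<beta>) ^ m = of_int c1 * \<beta> + of_int c2 * \<beta>\<^sup>2" by blast
      then have Rr: "(of_int Y - \<beta>) ^ m = of_int (3 * f0) + of_int (3 * f1 + c1) * \<beta> + of_int (3 * f2 + c2) * \<beta>\<^sup>2"
        unfolding f(2) fe by (simp add: algebra_simps)
      have "X ^ n + (X ^ 3 - 1) * e2 = 3 * f0"
        using coordinates_relation(1)[OF rel[unfolded L Rr]] .
      then have "3 dvd X ^ n" using a3 by (metis dvd_add_left_iff dvd_mult2 dvd_triv_left)
      then have "3 dvd X" using prime_dvd_power[of 3 X n] by simp
      then show False using mod(1) by presburger
    qed
    moreover have "3 dvd int n"
    proof (rule ccontr)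
      assume "\<not> 3 dvd int n"
      then have "multiplicity 3 (int m) = 0" using v by (simp add: not_dvd_imp_multiplicity_0)
      then have "\<not> 3 dvd int m" using n(2) by (simp add: multiplicity_eq_zero_iff)
      then show False using 3 by presburger
    qed
    ultimately show ?thesis by presburger
  qed
  have pos: "of_int X - \<alpha> > 0" "of_int Y - \<beta> > 0"
    using cube_root_less[OF XY(1) \<alpha>(2)] cube_root_less[OF XY(2) \<beta>(2)] by auto
  \<comment> \<open>Infinite descent on \<open>n\<close>: both bases are positive reals, so the
    common factor 3 of the exponents can be removed by taking cube roots.\<close>
  have "\<not> ((of_int X - \<alpha>) ^ n = (of_int Y - \<beta>) ^ m)" if "n > 0" "m > 0" for n m
    using that
  proof (induction n arbitrary: m rule: less_induct)
    case (less n)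
    show ?case
    proof
      assume rel: "(of_int X - \<alpha>) ^ n = (of_int Y - \<beta>) ^ m"
      obtain n' m' where nm: "n = 3 * n'" "m = 3 * m'" using descent[OF rel less.prems] by (auto elim!: dvdE)
      have "((of_int X - \<alpha>) ^ n') ^ 3 = ((of_int Y - \<beta>) ^ m') ^ 3"
        using rel unfolding nm by (metis mult.commute power_mult)
      then have "(of_int X - \<alpha>) ^ n' = (of_int Y - \<beta>) ^ m'"
        using pos by (auto dest!: power_eq_imp_eq_base)
      moreover have "n' < n" "n' > 0" "m' > 0" using nm less.prems by auto
      ultimately show False using less.IH by blast
    qed
  qed
  then show False using unit_relation[OF XY \<alpha> \<beta> \<alpha>\<beta>] by blast
qed

end

lemma cubic_solutionI:
  fixes X Y Z :: int
  assumes "X > 1" "Y > 1" "Z > 0" "(X ^ 3 - 1) * (Y ^ 3 - 1) = Z ^ 3"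
  shows "cubic_solution X Y Z (root 3 (of_int (X ^ 3 - 1))) (root 3 (of_int (Y ^ 3 - 1)))"
proof -
  have gt: "x ^ 3 > 1" if "x > 1" for x :: int using that by (intro one_less_power) auto
  have "root 3 (of_int (X ^ 3 - 1)) * root 3 (of_int (Y ^ 3 - 1)) = root 3 (real_of_int (Z ^ 3))"
    by (simp only: real_root_mult[symmetric] of_int_mult[symmetric] assms(4))
  also have "\<dots> = of_int Z" by (simp add: odd_real_root_power_cancel)
  finally show ?thesis
    using assms gt[of X] gt[of Y] by unfold_locales (auto simp: odd_real_root_pow simp del: of_int_diff)
qed

section \<open>Elimination of the residue classes\<close>

text \<open>By the valuations, 3 divides \<open>Z\<close> exactly when it divides \<open>X\<close>
  or \<open>Y\<close>. If it divides neither, the left side is 0 or 4 modulo 9, never a cube prime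
  to 3; if it divides one, the other must be 1 modulo 3, which the descent excludes in both
  orders.\<close>

lemma no_solution_cubes:
  fixes X Y Z :: int
  assumes XY: "X > 1" "Y > 1" and Z: "Z > 0" and eq: "(X ^ 3 - 1) * (Y ^ 3 - 1) = Z ^ 3"
  shows False
proof -
  interpret cubic_solution X Y Z "root 3 (of_int (X ^ 3 - 1))" "root 3 (of_int (Y ^ 3 - 1))"
    by (rule cubic_solutionI[OF assms])
  have eq': "(Y ^ 3 - 1) * (X ^ 3 - 1) = Z ^ 3" using eq by (simp add: mult.commute)
  interpret sym: cubic_solution Y X Z "root 3 (of_int (Y ^ 3 - 1))" "root 3 (of_int (X ^ 3 - 1))"
    by (rule cubic_solutionI[OF XY(2,1) Z eq'])
  obtain n m where nm: "n > 0" "m > 0" "(of_int X - root 3 (of_int (X ^ 3 - 1))) ^ n = (of_int Y - root 3 (of_int (Y ^ 3 - 1))) ^ m"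
    using unit_relation[OF XY \<alpha> \<beta> \<alpha>\<beta>] by blast
  have val: "multiplicity 3 Z = multiplicity 3 X + multiplicity 3 Y"
    by (rule valuation_relations(1)[OF nm(3,1,2)])
  have pos: "multiplicity 3 w > 0 \<longleftrightarrow> 3 dvd w" if "w > 0" for w :: int
    using that prime_elem_multiplicity_eq_zero_iff[of 3 w] by auto
  have dvd: "3 dvd Z \<longleftrightarrow> 3 dvd X \<or> 3 dvd Y"
    using pos[of X] pos[of Y] pos[of Z] val XY Z by auto
  have cube: "w ^ 3 mod 9 = (if w mod 3 = 0 then 0 else if w mod 3 = 1 then 1 else 8)" for w :: int
  proof -
    have "w mod 3 = 0 \<or> w mod 3 = 1 \<or> w mod 3 = 2" by presburger
    moreover define t where "t = w div 3"
    have "w = 3 * t + w mod 3" by (simp add: t_def)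
    ultimately consider "w = 3 * t" | "w = 3 * t + 1" | "w = 3 * t + 2" by fastforce
    then show ?thesis
    proof cases
      case 1
      then have "w ^ 3 = 9 * (3 * t ^ 3)" by (simp add: power3_eq_cube)
      then show ?thesis using 1 by simp
    next
      case 2
      then have "w ^ 3 = 1 + 9 * (3 * t ^ 3 + 3 * t\<^sup>2 + t)" by (simp add: power3_eq_cube power2_eq_square algebra_simps)
      then have "w ^ 3 mod 9 = 1" by presburger
      moreover have "w mod 3 = 1" using 2 by presburger
      ultimately show ?thesis by simp
    next
      case 3
      then have "w ^ 3 = 8 + 9 * (3 * t ^ 3 + 6 * t\<^sup>2 + 4 * t)" by (simp add: power3_eq_cube power2_eq_square algebra_simps)
      then have "w ^ 3 mod 9 = 8" by presburger
      moreover have "w mod 3 = 2" using 3 by presburger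
      ultimately show ?thesis by simp
    qed
  qed
  have key: "((X ^ 3 mod 9 - 1) * (Y ^ 3 mod 9 - 1)) mod 9 = Z ^ 3 mod 9"
    unfolding eq[symmetric] by (intro mod_mult_cong mod_diff_cong) auto
  have dvd': "Z mod 3 = 0 \<longleftrightarrow> X mod 3 = 0 \<or> Y mod 3 = 0" using dvd by (simp add: dvd_eq_mod_eq_0)
  have ex: "\<not> (X mod 3 = 1 \<and> Y mod 3 = 0)" "\<not> (Y mod 3 = 1 \<and> X mod 3 = 0)"
    using no_solution_1_0_mod_3 sym.no_solution_1_0_mod_3 by auto
  have "X mod 3 = 0 \<or> X mod 3 = 1 \<or> X mod 3 = 2" "Y mod 3 = 0 \<or> Y mod 3 = 1 \<or> Y mod 3 = 2"
    "Z mod 3 = 0 \<or> Z mod 3 = 1 \<or> Z mod 3 = 2" by presburger+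
  then show False using key ex dvd' unfolding cube by (elim disjE) simp_all
qed

section \<open>All odd prime exponents\<close>

theorem theorem1:
  shows "\<not> (\<exists>(X::int) (Y::int) (Z::int) (q::nat).
           1 < X \<and> X \<le> Y \<and> prime q \<and> odd q \<and>
           (X ^ q - 1) * (Y ^ q - 1) = Z ^ q)"
proof (rule notI, elim exE conjE)
  fix X Y Z :: int and q :: nat
  assume XY: "1 < X" "X \<le> Y" and q: "prime q" "odd q" and eq: "(X ^ q - 1) * (Y ^ q - 1) = Z ^ q"
  have "q > 1" using q(1) by (rule prime_gt_1_nat)
  have "X ^ q > 1" "Y ^ q > 1" using XY \<open>q > 1\<close> by (auto intro!: one_less_power)
  then have "Z ^ q > 0" unfolding eq[symmetric] by simp
  \<comment> \<open>The sign of \<open>Z\<close> is not assumed; it follows because \<open>q\<close>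
    is odd.\<close>
  then have Z: "Z > 0" using q(2) by (auto simp: zero_less_power_eq)
  have "q = 3 \<or> q \<ge> 5" using q(2) \<open>q > 1\<close> by presburger
  then show False
  proof
    assume "q = 3"
    then show False using no_solution_cubes[of X Y Z] XY Z eq by simp
  next
    assume "q \<ge> 5"
    then show False using no_solution_exponent_ge_5[OF q(1) _ XY Z eq] by simp
  qed
qed

end
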